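(* Let $\epsilon_1,\epsilon_2>0$ be constants for which the following global well-posedness statement holds (with $q=\infty$): whenever $U$ is divergence free with $U\in C([0,\infty);L^{3,\infty}(\mathbb R^3))$ and $\sup_{t\ge0}\|U(\cdot,t)\|_{L^{3,\infty}}<A<\epsilon_1$, and $u_0\in L^{3,\infty}$ is divergence free with $\|u_0\|_{L^{3,\infty}}<\epsilon_2$, there is a unique $u\in C([0,\infty);L^{3,\infty})$ solving \[ u(x,t)=e^{t\Delta}u_0 - \int_{0}^{t}e^{(t-s)\Delta}\mathbb P\nabla\cdot (u \otimes u)(s)\,ds -\int_{0}^{t}e^{(t-s)\Delta}\mathbb P\big(u\cdot \nabla U+U\cdot \nabla u\big)(s)\,ds, \] with $\|u\|_{L^\infty(0,\infty;L^{3,\infty})}\le C\|u_0\|_{L^{3,\infty}}$. Let $U(x,t)=u_L(x)$ where $u_L$ is a Landau solution with $\|u_L\|_{L^{3,\infty}}<\epsilon_1$. Then for every $\epsilon\in(0,\epsilon_2)$ there exists a divergence-free $u_0\in L^{3,\infty}$ with $\|u_0\|_{L^{3,\infty}}<\epsilon$ such that the corresponding solution $u$ satisfies \[ \limsup_{t\to\infty}\|u(\cdot,t)\|_{L^{3,\infty}}>0. \]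
   Context: For measurable $f$ on $\mathbb R^3$, $\|f\|_{L^{3,\infty}}=\sup_{\alpha>0}\alpha\,|\{|f|>\alpha\}|^{1/3}$ (weak-$L^3$). A Landau solution is a member of the explicit family of stationary solutions $(u_L,p_L)$ of the Navier–Stokes equations on $\mathbb R^3\setminus\{0\}$ that are homogeneous of degree $-1$ ($u_L(\lambda x)=\lambda^{-1}u_L(x)$), smooth away from the origin, axisymmetric, and solve the stationary Navier–Stokes equations in $\mathbb R^3$ with a point force (a multiple of the Dirac delta at the origin, "jet"). $e^{t\Delta}$ is the heat semigroup and $\mathbb P$ the Leray projector. Continuity in $L^{3,\infty}$ at $t=0$ is understood with respect to $L^{3/2,1}$–$L^{3,\infty}$ duality. *)

theory Defs
  imports "HOL-Analysis.Analysis"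
begin

type_synonym vec3 = "real^3"
type_synonym field3 = "vec3 \<Rightarrow> vec3"

definition distf :: "(vec3 \<Rightarrow> 'b::real_normed_vector) \<Rightarrow> real \<Rightarrow> ennreal" where
  "distf f \<alpha> = emeasure lborel {x. \<alpha> < norm (f x)}"

definition enn_powr :: "ennreal \<Rightarrow> real \<Rightarrow> ennreal" where
  "enn_powr m r = (if m = \<infinity> then \<infinity> else ennreal (enn2real m powr r))"

definition wL3 :: "(vec3 \<Rightarrow> 'b::real_normed_vector) \<Rightarrow> ennreal" where
  "wL3 f = (SUP \<alpha>\<in>{0<..}. ennreal \<alpha> * enn_powr (distf f \<alpha>) (1/3))"

definition L3w :: "(vec3 \<Rightarrow> 'b::real_normed_vector) \<Rightarrow> bool" where
  "L3w f \<longleftrightarrow> f \<in> borel_measurable lborel \<and> wL3 f < \<infinity>"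

definition L321 :: "(vec3 \<Rightarrow> 'b::real_normed_vector) \<Rightarrow> bool" where
  "L321 f \<longleftrightarrow> f \<in> borel_measurable lborel \<and>
     (\<integral>\<^sup>+ \<alpha>. indicator {0<..} \<alpha> * enn_powr (distf f \<alpha>) (2/3) \<partial>lborel) < \<infinity>"

definition pd :: "3 \<Rightarrow> (vec3 \<Rightarrow> 'b::real_normed_vector) \<Rightarrow> vec3 \<Rightarrow> 'b" where
  "pd i f x = frechet_derivative f (at x) (axis i 1)"

definition testfn :: "(vec3 \<Rightarrow> 'b::real_normed_vector) \<Rightarrow> bool" where
  "testfn \<phi> \<longleftrightarrow> (\<forall>x. \<phi> differentiable (at x)) \<and>
     (\<forall>i::3. continuous_on UNIV (pd i \<phi>)) \<and> bounded {x. \<phi> x \<noteq> 0}"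

definition divg :: "field3 \<Rightarrow> vec3 \<Rightarrow> real" where
  "divg \<phi> x = (\<Sum>i\<in>(UNIV::3 set). pd i \<phi> x $ i)"

definition divfree :: "field3 \<Rightarrow> bool" where
  "divfree f \<longleftrightarrow> (\<forall>\<psi>::vec3 \<Rightarrow> real. testfn \<psi> \<longrightarrow>
      (\<integral>x. (\<Sum>i\<in>(UNIV::3 set). f x $ i * pd i \<psi> x) \<partial>lborel) = 0)"

definition heat_kernel :: "real \<Rightarrow> vec3 \<Rightarrow> real" where
  "heat_kernel t z = (4 * pi * t) powr (-3/2) * exp (- (norm z)\<^sup>2 / (4 * t))"

definition heat :: "real \<Rightarrow> (vec3 \<Rightarrow> 'b::{banach,second_countable_topology}) \<Rightarrow> vec3 \<Rightarrow> 'b" where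
  "heat t f x = (if t \<le> 0 then f x else (\<integral>y. heat_kernel t (x - y) *\<^sub>R f y \<partial>lborel))"

definition CL3w :: "(real \<Rightarrow> field3) \<Rightarrow> bool" where
  "CL3w u \<longleftrightarrow> (\<forall>t\<ge>0. L3w (u t)) \<and>
     (\<forall>t>0. ((\<lambda>s. wL3 (\<lambda>x. u s x - u t x)) \<longlongrightarrow> 0) (at t within {0..})) \<and>
     (\<forall>\<phi>::field3. L321 \<phi> \<longrightarrow>
        ((\<lambda>t. \<integral>x. u t x \<bullet> \<phi> x \<partial>lborel) \<longlongrightarrow> (\<integral>x. u 0 x \<bullet> \<phi> x \<partial>lborel)) (at_right 0))"

text \<open>u solves the perturbed integral equation around U with data u0, the Duhamel terms being
  understood in duality with divergence-free test fields (the Leray projector then drops out):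
  <e^{(t-s)Delta} P div G, phi> = - <G, grad e^{(t-s)Delta} phi>, with
  G = u (x) u + U (x) u + u (x) U, using u.grad U + U.grad u = div(U (x) u + u (x) U).\<close>
definition mild_sol :: "(real \<Rightarrow> field3) \<Rightarrow> field3 \<Rightarrow> (real \<Rightarrow> field3) \<Rightarrow> bool" where
  "mild_sol U u0 u \<longleftrightarrow> CL3w u \<and> (\<forall>t\<ge>0. divfree (u t)) \<and>
     (\<forall>t\<ge>0. \<forall>\<phi>::field3. testfn \<phi> \<and> (\<forall>x. divg \<phi> x = 0) \<longrightarrow>
        (\<integral>x. u t x \<bullet> \<phi> x \<partial>lborel) =
          (\<integral>x. heat t u0 x \<bullet> \<phi> x \<partial>lborel)
          + set_lebesgue_integral lborel {0..t} (\<lambda>s.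
              \<integral>y. (\<Sum>j\<in>(UNIV::3 set). \<Sum>k\<in>(UNIV::3 set).
                    (u s y $ j * u s y $ k + U s y $ j * u s y $ k + u s y $ j * U s y $ k)
                    * (pd k (heat (t - s) \<phi>) y $ j)) \<partial>lborel))"

definition sup_norm :: "(real \<Rightarrow> field3) \<Rightarrow> ennreal" where
  "sup_norm u = (SUP t\<in>{0..}. wL3 (u t))"

definition gwp_const :: "real \<Rightarrow> real \<Rightarrow> real \<Rightarrow> bool" where
  "gwp_const \<epsilon>2 A C \<longleftrightarrow> (\<forall>U u0.
     CL3w U \<and> (\<forall>t\<ge>0. divfree (U t)) \<and> sup_norm U < ennreal A \<and>
     L3w u0 \<and> divfree u0 \<and> wL3 u0 < ennreal \<epsilon>2 \<longrightarrow>
     (\<exists>u. mild_sol U u0 u \<and> sup_norm u \<le> ennreal C * wL3 u0 \<and>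
        (\<forall>v. mild_sol U u0 v \<and> sup_norm v \<le> ennreal C * wL3 u0 \<longrightarrow>
             (\<forall>t\<ge>0. AE x in lborel. v t x = u t x))))"

text \<open>Landau's explicit solution with axis e (unit) and parameter a, |a|>1 (viscosity 1):
  in spherical coordinates around e, u_r = (2/r)((a^2-1)/(a-cos th)^2 - 1),
  u_th = -2 sin th/(r(a - cos th)), u_phi = 0; pressure 4(a cos th - 1)/(r^2(a-cos th)^2).\<close>
definition landau :: "real \<Rightarrow> vec3 \<Rightarrow> field3" where
  "landau a e x = (if x = 0 then 0 else
     (let r = norm x; c = (x \<bullet> e) / r in
       (2 / r) *\<^sub>R ((((a\<^sup>2 - 1) / (a - c)\<^sup>2 - 1) / r) *\<^sub>R x
                    - (1 / (a - c)) *\<^sub>R ((c / r) *\<^sub>R x - e))))"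

text \<open>The Landau family (the parameter value corresponding to zero force gives u = 0).\<close>
definition is_landau :: "field3 \<Rightarrow> bool" where
  "is_landau v \<longleftrightarrow> v = (\<lambda>_. 0) \<or> (\<exists>a e. \<bar>a\<bar> > 1 \<and> norm e = 1 \<and> v = landau a e)"

end

theory Submission
  imports Defs
begin

text \<open>Take as data the small vortex \<open>u0 x = c (e \<times> x) / |x|\<^sup>2\<close>, which like the Landau solution is solenoidal and
  homogeneous of degree -1. The integral equation is then invariant under
  \<open>u(x, t) \<mapsto> l u(l x, l\<^sup>2 t)\<close>, so by uniqueness \<open>u\<close> is self-similar and the scale-invariant norm
  \<open>wL3 (u t)\<close> is constant for \<open>t > 0\<close>. If it were zero, weak continuity at the initial time would make \<open>u0\<close>
  orthogonal to all solenoidal test fields, which fails for a cut-off of the vortex.\<close>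

section \<open>Scaling\<close>

text \<open>Uniqueness is available only among solutions with
  \<open>sup_norm u \<le> ennreal C * wL3 u0\<close>, so a rescaled solution has to be placed in the
  same class; this includes continuity at time zero, which is a statement about duality. The
  equation is tested against solenoidal fields and its integrals carry no integrability statement,
  hence the changes of variable are proved without any. What enters about the Landau field is
  smallness, homogeneity and zero divergence in the sense of distributions across the origin, where
  fields of degree -1 are singular. Both the Landau field and the vortex are therefore obtained as
  limits of C^1 solenoidal fields on the whole space, dominated by a multiple of 1/|x|, which is
  locally integrable in dimension three. The vortex is convenient because a rotation field stays
  solenoidal after multiplication by any radial profile: regularising it at the origin and cutting
  it off at infinity cost nothing.\<close>

lemma lborel_scaleR:
  assumes "c \<noteq> 0"
  shows "lborel = density (distr lborel borel (\<lambda>x::'a::euclidean_space. c *\<^sub>R x)) (\<lambda>_. ennreal (\<bar>c\<bar> ^ DIM('a)))"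
  using lborel_affine[OF assms, of 0] by (simp add: ennreal_power)

lemma borel_measurable_scaleR_iff:
  fixes f :: "'a::euclidean_space \<Rightarrow> 'b::topological_space"
  assumes "c \<noteq> 0"
  shows "(\<lambda>x. f (c *\<^sub>R x)) \<in> borel_measurable borel \<longleftrightarrow> f \<in> borel_measurable borel"
proof
  assume m: "(\<lambda>x. f (c *\<^sub>R x)) \<in> borel_measurable borel"
  have "(\<lambda>x. f (c *\<^sub>R ((1 / c) *\<^sub>R x))) \<in> borel_measurable borel"
    by (rule measurable_compose[OF _ m]) simp
  then show "f \<in> borel_measurable borel" using assms by simp
next
  assume m: "f \<in> borel_measurable borel"
  show "(\<lambda>x. f (c *\<^sub>R x)) \<in> borel_measurable borel"
    by (rule measurable_compose[OF _ m]) simp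
qed

text \<open>Neither integrability nor measurability is assumed: a dilation preserves both, and where
  one fails both Bochner integrals take the default value 0. Pairings and Duhamel terms can thus be
  rescaled without being estimated.\<close>

lemma lborel_integral_scaleR:
  fixes f :: "'a::euclidean_space \<Rightarrow> 'b::{banach, second_countable_topology}"
  assumes c: "c \<noteq> 0"
  shows "(\<integral>x. f x \<partial>lborel) = (\<bar>c\<bar> ^ DIM('a)) *\<^sub>R (\<integral>x. f (c *\<^sub>R x) \<partial>lborel)"
proof (cases "f \<in> borel_measurable borel")
  case True
  have "(\<integral>x. f x \<partial>lborel)
      = (\<integral>x. f x \<partial>density (distr lborel borel (\<lambda>x. c *\<^sub>R x)) (\<lambda>_. ennreal (\<bar>c\<bar> ^ DIM('a))))"
    using lborel_scaleR[OF c] by metis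
  also have "\<dots> = (\<bar>c\<bar> ^ DIM('a)) *\<^sub>R (\<integral>x. f (c *\<^sub>R x) \<partial>lborel)"
    using True by (subst integral_density) (simp_all add: integral_distr)
  finally show ?thesis .
next
  case False
  then have "\<not> integrable lborel f" "\<not> integrable lborel (\<lambda>x. f (c *\<^sub>R x))"
    using borel_measurable_scaleR_iff[OF c, of f] by (auto simp: integrable_iff_bounded)
  then show ?thesis by (simp add: not_integrable_integral_eq)
qed

lemma lborel_integral_shift:
  fixes f :: "'a::euclidean_space \<Rightarrow> 'b::{banach, second_countable_topology}"
  assumes [measurable]: "f \<in> borel_measurable borel"
  shows "(\<integral>x. f (x + v) \<partial>lborel) = (\<integral>x. f x \<partial>lborel)"
proof -
  have "(\<integral>x. f x \<partial>lborel) = (\<integral>x. f x \<partial>distr lborel borel ((+) v))"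
    by (simp add: lborel_distr_plus)
  also have "\<dots> = (\<integral>x. f (x + v) \<partial>lborel)"
    by (subst integral_distr) (simp_all add: add.commute)
  finally show ?thesis by simp
qed

lemma lborel_integrable_shift:
  fixes f :: "'a::euclidean_space \<Rightarrow> 'b::{banach, second_countable_topology}"
  assumes "integrable lborel f"
  shows "integrable lborel (\<lambda>x. f (x + v))"
proof -
  have "integrable (distr lborel borel ((+) v)) f"
    using assms by (simp only: lborel_distr_plus)
  then have "integrable lborel (\<lambda>x. f (v + x))"
    by (rule integrable_distr[rotated]) simp
  then show ?thesis by (simp only: add.commute)
qed

lemma emeasure_lborel_scaleR:
  fixes A :: "'a::euclidean_space set"
  assumes c: "c \<noteq> 0" and A: "A \<in> sets borel"
  shows "emeasure lborel A = ennreal (\<bar>c\<bar> ^ DIM('a)) * emeasure lborel {x. c *\<^sub>R x \<in> A}"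
proof -
  have "emeasure lborel A
      = emeasure (density (distr lborel borel (\<lambda>x. c *\<^sub>R x)) (\<lambda>_. ennreal (\<bar>c\<bar> ^ DIM('a)))) A"
    using lborel_scaleR[OF c] by metis
  then show ?thesis
    using A by (simp add: emeasure_density_const emeasure_distr vimage_def)
qed

section \<open>Distribution functions and Lorentz norms under dilation\<close>

lemma enn_powr_cmult:
  assumes "c > 0" "r > 0"
  shows "enn_powr (ennreal c * m) r = ennreal (c powr r) * enn_powr m r"
  using assms
  by (cases m) (auto simp: enn_powr_def ennreal_mult_top ennreal_mult[symmetric] powr_mult)

lemma enn_powr_eq_0_iff: "enn_powr m r = 0 \<longleftrightarrow> m = 0"
  by (cases m) (auto simp: enn_powr_def)

lemma enn_powr_mono:
  assumes "r > 0" "m \<le> m'" shows "enn_powr m r \<le> enn_powr m' r"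
  using assms
  by (cases m; cases m')
     (auto simp: enn_powr_def top_unique intro!: powr_mono2 ennreal_leI)

lemma distf_scaleR:
  fixes f :: "vec3 \<Rightarrow> 'b::real_normed_vector"
  assumes "f \<in> borel_measurable borel" "l > 0"
  shows "distf f \<alpha> = ennreal (l ^ 3) * distf (\<lambda>x. f (l *\<^sub>R x)) \<alpha>"
proof -
  have "{x. \<alpha> < norm (f x)} \<in> sets borel"
    using assms(1) by measurable
  from emeasure_lborel_scaleR[OF _ this, of l] assms(2) show ?thesis
    by (simp add: distf_def)
qed

lemma distf_cmult:
  fixes f :: "vec3 \<Rightarrow> 'b::real_normed_vector"
  assumes "c > 0"
  shows "distf (\<lambda>x. c *\<^sub>R f x) \<alpha> = distf f (\<alpha> / c)"
  using assms by (simp add: distf_def field_simps)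

text \<open>The set where \<open>l *\<^sub>R f (l *\<^sub>R x)\<close> exceeds
  \<open>l * \<alpha>\<close> in norm is the \<open>\<alpha>\<close>-level set of \<open>f\<close>
  shrunk by \<open>l\<close>. Its measure is divided by \<open>l ^ 3\<close> and the cube root by
  \<open>l\<close>, which cancels the factor \<open>l\<close> in the height; then the supremum is
  reindexed.\<close>

lemma wL3_parabolic_scale:
  fixes f :: "vec3 \<Rightarrow> 'b::real_normed_vector"
  assumes f: "f \<in> borel_measurable borel" and l: "l > 0"
  shows "wL3 (\<lambda>x. l *\<^sub>R f (l *\<^sub>R x)) = wL3 f"
proof -
  have *: "ennreal (l * \<alpha>) * enn_powr (distf (\<lambda>x. l *\<^sub>R f (l *\<^sub>R x)) (l * \<alpha>)) (1/3)
      = ennreal \<alpha> * enn_powr (distf f \<alpha>) (1/3)" if "\<alpha> > 0" for \<alpha>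
  proof -
    have "enn_powr (distf f \<alpha>) (1/3) = ennreal ((l ^ 3) powr (1/3)) * enn_powr (distf (\<lambda>x. f (l *\<^sub>R x)) \<alpha>) (1/3)"
      using l by (subst distf_scaleR[OF f l], subst enn_powr_cmult) auto
    also have "(l ^ 3) powr (1/3) = l"
      using l powr_powr[of l 3 "1/3"] by simp
    finally show ?thesis
      using l that by (simp add: distf_cmult ennreal_mult mult_ac)
  qed
  have im: "{0::real<..} = (\<lambda>\<alpha>. l * \<alpha>) ` {0<..}"
  proof (intro equalityI subsetI)
    fix x :: real assume "x \<in> {0<..}"
    then show "x \<in> (\<lambda>\<alpha>. l * \<alpha>) ` {0<..}" using l by (intro image_eqI[of _ _ "x / l"]) auto
  qed (use l in auto)
  have "wL3 (\<lambda>x. l *\<^sub>R f (l *\<^sub>R x))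
     = (SUP \<alpha>\<in>(\<lambda>\<alpha>. l * \<alpha>) ` {0<..}. ennreal \<alpha> * enn_powr (distf (\<lambda>x. l *\<^sub>R f (l *\<^sub>R x)) \<alpha>) (1/3))"
    unfolding wL3_def by (subst im[symmetric]) (rule refl)
  also have "\<dots> = (SUP \<alpha>\<in>{0<..}. ennreal (l * \<alpha>) * enn_powr (distf (\<lambda>x. l *\<^sub>R f (l *\<^sub>R x)) (l * \<alpha>)) (1/3))"
    by (simp add: image_image)
  also have "\<dots> = wL3 f"
    unfolding wL3_def by (rule SUP_cong) (use * in auto)
  finally show ?thesis .
qed

text \<open>Uniqueness in \<open>gwp_const\<close> holds up to null sets, so the norm must not see
  them.\<close>

lemma wL3_cong_AE:
  fixes f g :: "vec3 \<Rightarrow> 'b::{real_normed_vector, second_countable_topology}"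
  assumes "f \<in> borel_measurable borel" "g \<in> borel_measurable borel" "AE x in lborel. f x = g x"
  shows "wL3 f = wL3 g"
proof -
  have "distf f \<alpha> = distf g \<alpha>" for \<alpha>
    unfolding distf_def
  proof (rule emeasure_eq_AE)
    show "AE x in lborel. x \<in> {x. \<alpha> < norm (f x)} \<longleftrightarrow> x \<in> {x. \<alpha> < norm (g x)}"
      using assms(3) by eventually_elim simp
  qed (use assms(1,2) in measurable)
  then show ?thesis by (simp add: wL3_def)
qed

text \<open>A vanishing supremum makes each level set at height \<open>1 / real (Suc n)\<close>
  null, and these countably many sets exhaust the set where \<open>f\<close> is nonzero.\<close>

lemma wL3_eq_0_imp_AE:
  fixes f :: "vec3 \<Rightarrow> 'b::{real_normed_vector, second_countable_topology}"
  assumes f [measurable]: "f \<in> borel_measurable borel" and 0: "wL3 f = 0"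
  shows "AE x in lborel. f x = 0"
proof -
  have "AE x in lborel. \<not> 1 / real (Suc n) < norm (f x)" for n
  proof (rule AE_I')
    have "ennreal (1 / Suc n) * enn_powr (distf f (1 / Suc n)) (1/3) \<le> wL3 f"
      unfolding wL3_def by (rule SUP_upper) simp
    then have "distf f (1 / Suc n) = 0"
      using 0 by (auto simp: enn_powr_eq_0_iff)
    then show "{x. 1 / real (Suc n) < norm (f x)} \<in> null_sets lborel"
      by (auto simp: distf_def null_sets_def)
  qed auto
  then have "AE x in lborel. \<forall>n. \<not> 1 / real (Suc n) < norm (f x)"
    by (simp add: AE_all_countable)
  then show ?thesis
  proof eventually_elim
    case (elim x)
    show ?case
    proof (rule ccontr)
      assume "f x \<noteq> 0"
      then have "0 < norm (f x)" by simp
      then obtain n where "1 / real (Suc n) < norm (f x)"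
        by (metis nat_approx_posE)
      with elim show False by blast
    qed
  qed
qed

lemma wL3_zero: "wL3 (\<lambda>_. 0) = 0"
proof -
  have "ennreal \<alpha> * enn_powr (distf (\<lambda>_. 0::'a) \<alpha>) (1/3) = 0" if "\<alpha> > 0" for \<alpha>
    using that by (simp add: distf_def enn_powr_def not_less)
  then show ?thesis unfolding wL3_def
    by (intro antisym SUP_least) auto
qed

text \<open>Weak continuity at time zero is tested against this class, and rescaling a solution
  moves the inverse dilation onto the test field. The defining integral merely picks up the factor
  l^(-2).\<close>

lemma L321_scaleR:
  fixes f :: "vec3 \<Rightarrow> 'b::real_normed_vector"
  assumes f: "L321 f" and l: "l > 0"
  shows "L321 (\<lambda>x. f (l *\<^sub>R x))"
proof -
  have m: "f \<in> borel_measurable borel" using f by (simp add: L321_def)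
  let ?g = "\<lambda>x. f (l *\<^sub>R x)"
  have mg: "?g \<in> borel_measurable borel"
    using m l borel_measurable_scaleR_iff[of l f] by auto
  have eq: "enn_powr (distf ?g \<alpha>) (2/3) = ennreal (((1/l) ^ 3) powr (2/3)) * enn_powr (distf f \<alpha>) (2/3)" for \<alpha>
    using l by (subst distf_scaleR[OF mg, of "1/l"], simp, subst enn_powr_cmult) auto
  have mm: "(\<lambda>\<alpha>. indicator {0<..} \<alpha> * enn_powr (distf f \<alpha>) (2/3)) \<in> borel_measurable lborel"
  proof -
    have "(\<lambda>\<alpha>. enn_powr (distf f \<alpha>) (2/3)) \<in> borel_measurable borel"
    proof (rule borel_measurableI_greater)
      fix y
      \<comment> \<open>The distribution function is nonincreasing, so this superlevel set contains
        every point below each of its points; being an interval, it is Borel.\<close>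
      have "is_interval {\<alpha>. y < enn_powr (distf f \<alpha>) (2/3)}"
        unfolding is_interval_1
      proof (intro ballI allI impI, elim conjE)
        fix a b x :: real assume b: "b \<in> {\<alpha>. y < enn_powr (distf f \<alpha>) (2/3)}" and "x \<le> b"
        have "distf f b \<le> distf f x"
          unfolding distf_def using \<open>x \<le> b\<close> m by (intro emeasure_mono) (auto, measurable)
        then have "enn_powr (distf f b) (2/3) \<le> enn_powr (distf f x) (2/3)"
          by (intro enn_powr_mono) simp_all
        then show "x \<in> {\<alpha>. y < enn_powr (distf f \<alpha>) (2/3)}" using b by auto
      qed
      then show "{x \<in> space borel. y < enn_powr (distf f x) (2/3)} \<in> sets borel"
        by (simp add: real_interval_borel_measurable)
    qed
    then show ?thesis by simp
  qed
  have "(\<integral>\<^sup>+ \<alpha>. indicator {0<..} \<alpha> * enn_powr (distf ?g \<alpha>) (2/3) \<partial>lborel)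
     = ennreal (((1/l) ^ 3) powr (2/3)) * (\<integral>\<^sup>+ \<alpha>. indicator {0<..} \<alpha> * enn_powr (distf f \<alpha>) (2/3) \<partial>lborel)"
    unfolding eq by (subst nn_integral_cmult[OF mm, symmetric]) (simp add: mult_ac)
  then show ?thesis
    using f mg unfolding L321_def by (simp add: ennreal_mult_less_top)
qed

section \<open>Test functions and the heat semigroup\<close>

lemma has_derivative_pd:
  fixes f :: "vec3 \<Rightarrow> 'b::real_normed_vector"
  assumes "f differentiable (at x)"
  shows "(f has_derivative (\<lambda>h. \<Sum>i\<in>UNIV. h $ i *\<^sub>R pd i f x)) (at x)"
proof -
  let ?D = "frechet_derivative f (at x)"
  have d: "(f has_derivative ?D) (at x)"
    using assms frechet_derivative_works by blast
  then interpret D: bounded_linear ?D by (rule has_derivative_bounded_linear)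
  have "?D h = (\<Sum>i\<in>UNIV. h $ i *\<^sub>R pd i f x)" for h :: vec3
  proof -
    have "?D h = ?D (\<Sum>i\<in>UNIV. h $ i *\<^sub>R axis i 1)"
      using basis_expansion[of h] by (simp add: scalar_mult_eq_scaleR)
    then show ?thesis by (simp add: D.sum D.scaleR pd_def)
  qed
  then have "?D = (\<lambda>h. \<Sum>i\<in>UNIV. h $ i *\<^sub>R pd i f x)" by (rule ext)
  then show ?thesis using d by metis
qed

lemma pd_eqI:
  assumes "(f has_derivative f') (at x)"
  shows "pd i f x = f' (axis i 1)"
  using frechet_derivative_at[OF assms] by (simp add: pd_def)

lemma pd_scaleR:
  fixes f :: "vec3 \<Rightarrow> 'b::real_normed_vector"
  assumes "f differentiable (at (c *\<^sub>R x))"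
  shows "(\<lambda>x. f (c *\<^sub>R x)) differentiable (at x)" "pd i (\<lambda>x. f (c *\<^sub>R x)) x = c *\<^sub>R pd i f (c *\<^sub>R x)"
proof -
  let ?D = "frechet_derivative f (at (c *\<^sub>R x))"
  have d: "(f has_derivative ?D) (at (c *\<^sub>R x))"
    using assms frechet_derivative_works by blast
  then interpret D: bounded_linear ?D by (rule has_derivative_bounded_linear)
  have "((\<lambda>x. c *\<^sub>R x) has_derivative (\<lambda>h. c *\<^sub>R h)) (at x)"
    by (auto intro!: derivative_eq_intros)
  from has_derivative_compose[OF this d]
  have *: "((\<lambda>x. f (c *\<^sub>R x)) has_derivative (\<lambda>h. ?D (c *\<^sub>R h))) (at x)" .
  then show "(\<lambda>x. f (c *\<^sub>R x)) differentiable (at x)" by (rule differentiableI)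
  show "pd i (\<lambda>x. f (c *\<^sub>R x)) x = c *\<^sub>R pd i f (c *\<^sub>R x)"
    using pd_eqI[OF *] by (simp add: D.scaleR pd_def)
qed

lemma testfn_scaleR:
  fixes \<phi> :: "vec3 \<Rightarrow> 'b::real_normed_vector"
  assumes t: "testfn \<phi>" and c: "c \<noteq> 0"
  shows "testfn (\<lambda>x. \<phi> (c *\<^sub>R x))"
  unfolding testfn_def
proof (intro conjI allI)
  have d: "\<phi> differentiable (at x)" for x using t by (simp add: testfn_def)
  show "(\<lambda>x. \<phi> (c *\<^sub>R x)) differentiable at x" for x by (rule pd_scaleR d)+
  show "continuous_on UNIV (pd i (\<lambda>x. \<phi> (c *\<^sub>R x)))" for i
  proof -
    have "continuous_on UNIV (pd i \<phi>)" using t by (simp add: testfn_def)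
    then have "continuous_on UNIV (\<lambda>x. pd i \<phi> (c *\<^sub>R x))"
      by (rule continuous_on_compose2) (auto intro!: continuous_intros)
    then have "continuous_on UNIV (\<lambda>x. c *\<^sub>R pd i \<phi> (c *\<^sub>R x))"
      by (intro continuous_on_scaleR continuous_on_const)
    moreover have "pd i (\<lambda>x. \<phi> (c *\<^sub>R x)) = (\<lambda>x. c *\<^sub>R pd i \<phi> (c *\<^sub>R x))"
      by (rule ext) (rule pd_scaleR(2)[OF d])
    ultimately show ?thesis by (simp only:)
  qed
  obtain B where B: "\<And>x. \<phi> x \<noteq> 0 \<Longrightarrow> norm x \<le> B"
    using t by (auto simp: testfn_def bounded_iff)
  show "bounded {x. \<phi> (c *\<^sub>R x) \<noteq> 0}"
    unfolding bounded_iff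
  proof (intro exI ballI)
    fix x assume "x \<in> {x. \<phi> (c *\<^sub>R x) \<noteq> 0}"
    then have "norm (c *\<^sub>R x) \<le> B" using B by blast
    then show "norm x \<le> B / \<bar>c\<bar>" using c by (simp add: field_simps)
  qed
qed

lemma testfn_continuous: "testfn \<phi> \<Longrightarrow> continuous_on UNIV \<phi>"
  by (simp add: testfn_def differentiable_imp_continuous_on differentiable_on_def)

lemma continuous_compact_support_bounded:
  fixes g :: "'a::euclidean_space \<Rightarrow> 'b::real_normed_vector"
  assumes "continuous_on UNIV g" "\<And>x. norm x > R \<Longrightarrow> g x = 0"
  obtains M where "M \<ge> 0" "\<And>x. norm (g x) \<le> M"
proof -
  have "bounded (g ` cball 0 R)"
    using assms(1) by (intro compact_imp_bounded compact_continuous_image) (auto intro: continuous_on_subset)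
  then obtain M where M: "\<And>x. x \<in> cball 0 R \<Longrightarrow> norm (g x) \<le> M"
    unfolding bounded_iff by blast
  show thesis
  proof (rule that[of "max 0 M"])
    fix x show "norm (g x) \<le> max 0 M"
      using M[of x] assms(2)[of x] by (cases "norm x \<le> R") (auto simp: le_max_iff_disj)
  qed simp
qed

text \<open>The complement of a closed ball is open, so a function that vanishes there has vanishing
  derivatives there as well.\<close>

lemma testfn_support:
  fixes \<phi> :: "vec3 \<Rightarrow> 'b::real_normed_vector"
  assumes t: "testfn \<phi>"
  obtains R where "\<And>x. norm x > R \<Longrightarrow> \<phi> x = 0" "\<And>x i. norm x > R \<Longrightarrow> pd i \<phi> x = 0"
proof -
  obtain R where R: "\<And>x. \<phi> x \<noteq> 0 \<Longrightarrow> norm x \<le> R"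
    using t by (auto simp: testfn_def bounded_iff)
  have z: "\<phi> x = 0" if "norm x > R" for x using R[of x] that by force
  have "pd i \<phi> x = 0" if "norm x > R" for x i
  proof -
    have "open {x::vec3. norm x > R}" by (intro open_Collect_less continuous_intros)
    then have "(\<phi> has_derivative (\<lambda>_. 0)) (at x)"
      by (rule has_derivative_transform_within_open[OF has_derivative_const[of 0]]) (use that z in auto)
    then show ?thesis by (rule pd_eqI)
  qed
  with z show thesis by (rule that)
qed

lemma integrable_bounded_support:
  fixes g :: "'a::euclidean_space \<Rightarrow> 'b::{banach, second_countable_topology}"
  assumes "g \<in> borel_measurable borel" "\<And>x. norm x > R \<Longrightarrow> g x = 0" "\<And>x. norm (g x) \<le> M"
  shows "integrable lborel g"
proof (rule Bochner_Integration.integrable_bound)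
  show "integrable lborel (\<lambda>x::'a. indicator (cball 0 R) x *\<^sub>R M)"
    by (intro integrable_scaleR_left integrable_real_indicator) (use emeasure_lborel_cball_finite[of "0::'a" R] in auto)
  show "AE x in lborel. norm (g x) \<le> norm (indicator (cball 0 R) x *\<^sub>R M)"
  proof (intro AE_I2)
    fix x show "norm (g x) \<le> norm (indicator (cball 0 R) x *\<^sub>R M)"
      using assms(2)[of x] assms(3)[of x] by (cases "norm x \<le> R") (auto simp: indicator_def)
  qed
qed (use assms(1) in simp)

lemma testfn_bounds:
  fixes \<phi> :: "vec3 \<Rightarrow> 'b::{banach, second_countable_topology}"
  assumes t: "testfn \<phi>"
  obtains R M where "R > 0" "M > 0" "\<And>x. norm x > R \<Longrightarrow> \<phi> x = 0" "\<And>x i. norm x > R \<Longrightarrow> pd i \<phi> x = 0"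
    "\<And>x. norm (\<phi> x) \<le> M" "\<And>x i. norm (pd i \<phi> x) \<le> M"
proof -
  obtain R where R: "\<And>x. norm x > R \<Longrightarrow> \<phi> x = 0" "\<And>x i. norm x > R \<Longrightarrow> pd i \<phi> x = 0"
    using testfn_support[OF t] by blast
  obtain M where M: "M \<ge> 0" "\<And>x. norm (\<phi> x) \<le> M"
    using continuous_compact_support_bounded[OF testfn_continuous[OF t] R(1)] by blast
  have "\<exists>M\<ge>0. \<forall>x. norm (pd i \<phi> x) \<le> M" for i
  proof -
    have "continuous_on UNIV (pd i \<phi>)" using t by (simp add: testfn_def)
    from continuous_compact_support_bounded[OF this R(2)] show ?thesis by metis
  qed
  then obtain N where N: "\<And>i. N i \<ge> 0" "\<And>i x. norm (pd i \<phi> x) \<le> N i" by metis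
  let ?K = "M + (\<Sum>i\<in>UNIV. N i) + 1"
  have s: "N i \<le> (\<Sum>i\<in>UNIV. N i)" for i by (rule member_le_sum) (use N in auto)
  show thesis
  proof (rule that[of "max 1 R" ?K])
    show "?K > 0" using M(1) N(1) by (simp add: add_nonneg_pos sum_nonneg)
    show "norm (\<phi> x) \<le> ?K" for x using M(2)[of x] N(1) sum_nonneg[of UNIV N] by simp
    show "norm (pd i \<phi> x) \<le> ?K" for x i using N(2)[of i x] s[of i] M(1) by simp
  qed (use R in auto)
qed

lemma testfn_integrable:
  fixes \<phi> :: "vec3 \<Rightarrow> 'b::{banach, second_countable_topology}"
  assumes t: "testfn \<phi>"
  shows "integrable lborel \<phi>" "integrable lborel (pd i \<phi>)"
proof -
  obtain R M where *: "\<And>x. norm x > R \<Longrightarrow> \<phi> x = 0" "\<And>x i. norm x > R \<Longrightarrow> pd i \<phi> x = 0"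
    "\<And>x. norm (\<phi> x) \<le> M" "\<And>x i. norm (pd i \<phi> x) \<le> M"
    using testfn_bounds[OF t] by metis
  show "integrable lborel \<phi>"
    by (rule integrable_bounded_support[OF _ *(1,3)])
       (use testfn_continuous[OF t] borel_measurable_continuous_onI in auto)
  show "integrable lborel (pd i \<phi>)"
    by (rule integrable_bounded_support[OF _ *(2,4)])
       (use t borel_measurable_continuous_onI in \<open>auto simp: testfn_def\<close>)
qed

text \<open>All level sets lie in one ball and are empty above the bound \<open>M\<close>, so the
  Lorentz integrand is dominated by a constant on a bounded interval. Test fields are thereby
  admissible in the weak limit at time zero.\<close>

lemma testfn_L321:
  fixes \<phi> :: "vec3 \<Rightarrow> 'b::{banach, second_countable_topology}"
  assumes t: "testfn \<phi>"
  shows "L321 \<phi>"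
proof -
  obtain R M where *: "R > 0" "M > 0" "\<And>x. norm x > R \<Longrightarrow> \<phi> x = 0" "\<And>x. norm (\<phi> x) \<le> M"
    using testfn_bounds[OF t] by metis
  let ?E = "emeasure lborel (cball (0::vec3) R)"
  have b: "distf \<phi> \<alpha> \<le> ?E" if "\<alpha> > 0" for \<alpha>
    unfolding distf_def using *(3) that by (intro emeasure_mono) (auto simp: not_less[symmetric] intro: ccontr)
  have z: "distf \<phi> \<alpha> = 0" if "\<alpha> > M" for \<alpha>
  proof -
    have "{x. \<alpha> < norm (\<phi> x)} = {}" using *(4) that by (auto simp: not_less intro: order_trans less_imp_le)
    then show ?thesis by (simp add: distf_def)
  qed
  have "(\<integral>\<^sup>+ \<alpha>. indicator {0<..} \<alpha> * enn_powr (distf \<phi> \<alpha>) (2/3) \<partial>lborel)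
      \<le> (\<integral>\<^sup>+ \<alpha>. enn_powr ?E (2/3) * indicator {0..M} \<alpha> \<partial>lborel)"
  proof (rule nn_integral_mono)
    fix \<alpha> :: real
    show "indicator {0<..} \<alpha> * enn_powr (distf \<phi> \<alpha>) (2/3) \<le> enn_powr ?E (2/3) * indicator {0..M} \<alpha>"
      using b[of \<alpha>] z[of \<alpha>]
      by (cases "\<alpha> > 0"; cases "\<alpha> > M") (auto simp: indicator_def enn_powr_mono enn_powr_eq_0_iff)
  qed
  also have "\<dots> = enn_powr ?E (2/3) * ennreal M"
    using *(2) by (subst nn_integral_cmult_indicator) auto
  also have "\<dots> < \<infinity>"
    using emeasure_lborel_cball_finite[of "0::vec3" R]
    by (simp add: ennreal_mult_less_top enn_powr_def less_top)
  finally show ?thesis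
    using testfn_continuous[OF t] borel_measurable_continuous_onI by (auto simp: L321_def)
qed

text \<open>Differentiation under the integral: a bounded gradient makes the kernel Lipschitz, so
  the remainder quotients are dominated by \<open>2 * B * norm (\<phi> y)\<close>. Arbitrary
  sequences tending to \<open>x\<close> are used because \<open>pd\<close> rests on the full Frechet
  derivative, not on directional ones.\<close>

lemma convolution_differentiable:
  fixes k :: "vec3 \<Rightarrow> real" and \<phi> :: "vec3 \<Rightarrow> 'b::{banach, second_countable_topology}"
  assumes k': "\<And>z. (k has_derivative (\<lambda>h. g z \<bullet> h)) (at z)"
    and g: "g \<in> borel_measurable borel"
    and B: "\<And>z. norm (g z) \<le> B" and K: "\<And>z. \<bar>k z\<bar> \<le> K"
    and \<phi>: "integrable lborel \<phi>"
  shows "(\<lambda>x. \<integral>y. k (x - y) *\<^sub>R \<phi> y \<partial>lborel) differentiable (at x)"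
proof -
  have [measurable]: "k \<in> borel_measurable borel"
    using k' by (intro borel_measurable_continuous_onI) (meson continuous_at_imp_continuous_on has_derivative_continuous)
  note [measurable] = g borel_measurable_integrable[OF \<phi>]
  have B0: "B \<ge> 0" using B[of 0] norm_ge_zero order_trans by blast
  have K0: "K \<ge> 0" using K[of 0] by simp
  let ?F = "\<lambda>x. \<integral>y. k (x - y) *\<^sub>R \<phi> y \<partial>lborel"
  let ?D = "\<lambda>h. \<integral>y. (g (x - y) \<bullet> h) *\<^sub>R \<phi> y \<partial>lborel"
  have dom: "norm (a *\<^sub>R \<phi> y) \<le> norm (C *\<^sub>R \<phi> y)" if "\<bar>a\<bar> \<le> C" for a C y
    using that by (auto intro!: mult_right_mono)
  have intk: "integrable lborel (\<lambda>y. k (z - y) *\<^sub>R \<phi> y)" for z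
    by (rule Bochner_Integration.integrable_bound[OF _ _ AE_I2[OF dom[OF K]]])
       (use \<phi> in auto)
  have gh: "\<bar>g z \<bullet> h\<bar> \<le> B * norm h" for z h
    by (rule order_trans[OF Cauchy_Schwarz_ineq2]) (intro mult_right_mono B norm_ge_zero)
  have intg: "integrable lborel (\<lambda>y. (g (x - y) \<bullet> h) *\<^sub>R \<phi> y)" for h
    by (rule Bochner_Integration.integrable_bound[OF _ _ AE_I2[OF dom[OF gh]]])
       (use \<phi> in auto)
  have bl: "bounded_linear ?D"
  proof (rule bounded_linear_intro)
    show "?D (h + h') = ?D h + ?D h'" for h h'
      by (simp add: inner_add_right scaleR_add_left intg)
    show "?D (r *\<^sub>R h) = r *\<^sub>R ?D h" for r h
      by (simp flip: integral_scaleR_right)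
    show "norm (?D h) \<le> norm h * (B * (\<integral>y. norm (\<phi> y) \<partial>lborel))" for h
    proof -
      have "norm (?D h) \<le> (\<integral>y. norm ((g (x - y) \<bullet> h) *\<^sub>R \<phi> y) \<partial>lborel)"
        by (rule integral_norm_bound)
      also have "\<dots> \<le> (\<integral>y. (B * norm h) * norm (\<phi> y) \<partial>lborel)"
      proof (rule integral_mono)
        show "integrable lborel (\<lambda>y. norm ((g (x - y) \<bullet> h) *\<^sub>R \<phi> y))" using intg by (rule integrable_norm)
        show "integrable lborel (\<lambda>y. (B * norm h) * norm (\<phi> y))" using \<phi> by simp
        show "norm ((g (x - y) \<bullet> h) *\<^sub>R \<phi> y) \<le> (B * norm h) * norm (\<phi> y)" for y
          using gh by (simp add: mult_right_mono)
      qed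
      finally show ?thesis by (simp add: mult_ac)
    qed
  qed
  have lip: "\<bar>k u - k v\<bar> \<le> B * norm (u - v)" for u v
  proof -
    have "norm (k u - k v) \<le> B * norm (u - v)"
    proof (rule differentiable_bound[of UNIV])
      show "(k has_derivative (\<lambda>h. g z \<bullet> h)) (at z within UNIV)" for z using k' by simp
      show "onorm (\<lambda>h. g z \<bullet> h) \<le> B" for z
        by (rule onorm_le) (use gh in simp)
    qed auto
    then show ?thesis by simp
  qed
  have "(?F has_derivative ?D) (at x)"
    unfolding has_derivative_at_within
  proof (intro conjI bl)
    show "((\<lambda>y. (?F y - ?F x - ?D (y - x)) /\<^sub>R norm (y - x)) \<longlongrightarrow> 0) (at x)"
      unfolding tendsto_at_iff_sequentially
    proof (intro allI impI)
      fix X assume X: "\<forall>i. X i \<in> UNIV - {x}" and Xx: "X \<longlonglongrightarrow> x"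
      let ?q = "\<lambda>n y. (k (X n - y) - k (x - y) - g (x - y) \<bullet> (X n - x)) / norm (X n - x)"
      have eq: "(?F (X n) - ?F x - ?D (X n - x)) /\<^sub>R norm (X n - x) = (\<integral>y. ?q n y *\<^sub>R \<phi> y \<partial>lborel)" for n
      proof -
        have "?F (X n) - ?F x - ?D (X n - x)
          = (\<integral>y. k (X n - y) *\<^sub>R \<phi> y - k (x - y) *\<^sub>R \<phi> y - (g (x - y) \<bullet> (X n - x)) *\<^sub>R \<phi> y \<partial>lborel)"
          by (simp add: intk intg)
        then show ?thesis
          by (simp add: scaleR_diff_left divide_inverse_commute flip: integral_scaleR_right scaleR_scaleR)
      qed
      have "(\<lambda>n. \<integral>y. ?q n y *\<^sub>R \<phi> y \<partial>lborel) \<longlonglongrightarrow> integral\<^sup>L lborel (\<lambda>y::vec3. 0::'b)"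
      proof (rule integral_dominated_convergence[where w="\<lambda>y. 2 * B * norm (\<phi> y)"])
        show "integrable lborel (\<lambda>y. 2 * B * norm (\<phi> y))" using \<phi> by simp
        show "AE y in lborel. (\<lambda>n. ?q n y *\<^sub>R \<phi> y) \<longlonglongrightarrow> 0"
        proof (intro AE_I2)
          fix y
          have "((\<lambda>z. (k z - k (x - y) - g (x - y) \<bullet> (z - (x - y))) /\<^sub>R norm (z - (x - y))) \<longlongrightarrow> 0) (at (x - y))"
            using k'[of "x - y"] by (simp add: has_derivative_at_within)
          moreover have "(\<lambda>n. X n - y) \<longlonglongrightarrow> x - y" by (intro tendsto_intros Xx)
          ultimately have "(\<lambda>n. ?q n y) \<longlonglongrightarrow> 0"
            unfolding tendsto_at_iff_sequentially using X
            by (auto dest!: spec[of _ "\<lambda>n. X n - y"] simp: o_def divide_inverse_commute)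
          then have "(\<lambda>n. ?q n y *\<^sub>R \<phi> y) \<longlonglongrightarrow> 0 *\<^sub>R \<phi> y" by (intro tendsto_intros)
          then show "(\<lambda>n. ?q n y *\<^sub>R \<phi> y) \<longlonglongrightarrow> 0" by simp
        qed
        show "AE y in lborel. norm (?q n y *\<^sub>R \<phi> y) \<le> 2 * B * norm (\<phi> y)" for n
        proof (intro AE_I2)
          fix y
          have "\<bar>k (X n - y) - k (x - y) - g (x - y) \<bullet> (X n - x)\<bar> \<le> 2 * B * norm (X n - x)"
            using lip[of "X n - y" "x - y"] gh[of "x - y" "X n - x"] by simp
          moreover have "norm (X n - x) > 0" using X by simp
          ultimately have "\<bar>?q n y\<bar> \<le> 2 * B" by (simp add: field_simps)
          then show "norm (?q n y *\<^sub>R \<phi> y) \<le> 2 * B * norm (\<phi> y)"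
            unfolding norm_scaleR by (rule mult_right_mono[OF _ norm_ge_zero])
        qed
      qed auto
      then show "((\<lambda>y. (?F y - ?F x - ?D (y - x)) /\<^sub>R norm (y - x)) \<circ> X) \<longlonglongrightarrow> 0"
        by (simp add: o_def eq)
    qed
  qed
  then show ?thesis by (rule differentiableI)
qed

text \<open>Rescaling the equation applies the chain rule to
  \<open>pd k (heat (t - s) \<phi>)\<close>, which requires differentiability. For nonpositive times
  \<open>heat\<close> returns the test field itself, so every \<open>\<tau>\<close> is
  covered.\<close>

lemma heat_differentiable:
  fixes \<phi> :: "vec3 \<Rightarrow> 'b::{banach, second_countable_topology}"
  assumes t: "testfn \<phi>"
  shows "heat \<tau> \<phi> differentiable (at x)"
proof (cases "\<tau> \<le> 0")
  case True
  then have "heat \<tau> \<phi> = \<phi>" by (auto simp: heat_def)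
  then show ?thesis using t by (simp add: testfn_def)
next
  case False
  then have tau: "\<tau> > 0" by simp
  let ?C = "(4 * pi * \<tau>) powr (-3/2)"
  let ?E = "\<lambda>z::vec3. exp (- (norm z)\<^sup>2 / (4 * \<tau>))"
  let ?g = "\<lambda>z::vec3. (- ?C * ?E z / (2 * \<tau>)) *\<^sub>R z"
  have "(\<lambda>x. \<integral>y. heat_kernel \<tau> (x - y) *\<^sub>R \<phi> y \<partial>lborel) differentiable (at x)"
  proof (rule convolution_differentiable[where g = ?g and K = ?C and B = "?C * (1 + 4 * \<tau>) / (2 * \<tau>)"])
    show "(heat_kernel \<tau> has_derivative (\<lambda>h. ?g z \<bullet> h)) (at z)" for z
      unfolding heat_kernel_def[abs_def] power2_norm_eq_inner
      using tau by (auto intro!: derivative_eq_intros simp: field_simps inner_commute)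
    show "?g \<in> borel_measurable borel" by measurable
    show "\<bar>heat_kernel \<tau> z\<bar> \<le> ?C" for z
      using tau by (simp add: heat_kernel_def abs_mult mult_left_le)
    \<comment> \<open>Origin of the constant: with \<open>u\<close> the Gaussian exponent, |z| \<le>
      1 + |z|^2 \<le> (1 + 4 \<tau>)(1 + u) \<le> (1 + 4 \<tau>) exp u, so the exponential absorbs
      the linear factor of the gradient.\<close>
    show "norm (?g z) \<le> ?C * (1 + 4 * \<tau>) / (2 * \<tau>)" for z
    proof -
      define u where "u = (norm z)\<^sup>2 / (4 * \<tau>)"
      have u0: "u \<ge> 0" and z2: "(norm z)\<^sup>2 = 4 * \<tau> * u" using tau by (simp_all add: u_def)
      have "norm z \<le> 1 + (norm z)\<^sup>2"
        using zero_le_power2[of "norm z - 1"] unfolding power2_diff by simp (smt (verit) norm_ge_zero)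
      also have "\<dots> \<le> (1 + 4 * \<tau>) * (1 + u)" using tau u0 z2 by (simp add: algebra_simps)
      also have "\<dots> \<le> (1 + 4 * \<tau>) * exp u" using tau by (intro mult_left_mono exp_ge_add_one_self) auto
      finally have "norm z * exp (- u) \<le> 1 + 4 * \<tau>" by (simp add: exp_minus field_simps)
      then have "?C * (norm z * exp (- u)) / (2 * \<tau>) \<le> ?C * (1 + 4 * \<tau>) / (2 * \<tau>)"
        using tau by (intro divide_right_mono mult_left_mono) auto
      then show ?thesis using tau by (simp add: u_def abs_mult mult_ac)
    qed
    show "integrable lborel \<phi>" using t by (rule testfn_integrable)
  qed
  moreover have "heat \<tau> \<phi> = (\<lambda>x. \<integral>y. heat_kernel \<tau> (x - y) *\<^sub>R \<phi> y \<partial>lborel)"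
    using tau by (auto simp: heat_def)
  ultimately show ?thesis by simp
qed

lemma heat_kernel_scaleR:
  assumes "l > 0" "\<tau> > 0"
  shows "heat_kernel (l\<^sup>2 * \<tau>) (l *\<^sub>R z) = heat_kernel \<tau> z / l ^ 3"
proof -
  have "(4 * pi * (l\<^sup>2 * \<tau>)) powr (-3/2) = (l\<^sup>2) powr (-3/2) * (4 * pi * \<tau>) powr (-3/2)"
    using assms by (subst powr_mult[symmetric]) (auto simp: mult_ac)
  also have "(l\<^sup>2) powr (-3/2) = l powr (-3)"
    using assms powr_powr[of l 2 "-3/2"] by simp
  also have "l powr (-3) = 1 / l ^ 3"
    using assms by (simp add: powr_minus_divide)
  finally have 1: "(4 * pi * (l\<^sup>2 * \<tau>)) powr (-3/2) = (4 * pi * \<tau>) powr (-3/2) / l ^ 3" by simp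
  have 2: "- (norm (l *\<^sub>R z))\<^sup>2 / (4 * (l\<^sup>2 * \<tau>)) = - (norm z)\<^sup>2 / (4 * \<tau>)"
    using assms by (simp add: power_mult_distrib field_simps)
  show ?thesis unfolding heat_kernel_def 1 2 by simp
qed

text \<open>Under joint dilation of space by \<open>l\<close> and of time by
  \<open>l\<^sup>2\<close> the Gaussian is only divided by \<open>l ^ 3\<close>, which the Jacobian
  restores.\<close>

lemma heat_scaleR:
  fixes f :: "vec3 \<Rightarrow> 'b::{banach, second_countable_topology}"
  assumes l: "l > 0"
  shows "heat (l\<^sup>2 * \<tau>) f (l *\<^sub>R x) = heat \<tau> (\<lambda>x. f (l *\<^sub>R x)) x"
proof (cases "\<tau> \<le> 0")
  case True
  then have "l\<^sup>2 * \<tau> \<le> 0" by (simp add: mult_nonneg_nonpos)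
  with True show ?thesis by (simp add: heat_def)
next
  case False
  then have "\<not> l\<^sup>2 * \<tau> \<le> 0" using l by (simp add: not_le)
  then have "heat (l\<^sup>2 * \<tau>) f (l *\<^sub>R x) = (\<integral>y. heat_kernel (l\<^sup>2 * \<tau>) (l *\<^sub>R x - y) *\<^sub>R f y \<partial>lborel)"
    by (simp add: heat_def)
  also have "\<dots> = l ^ 3 *\<^sub>R (\<integral>y. heat_kernel (l\<^sup>2 * \<tau>) (l *\<^sub>R x - l *\<^sub>R y) *\<^sub>R f (l *\<^sub>R y) \<partial>lborel)"
    using l by (subst lborel_integral_scaleR[of l]) auto
  also have "\<dots> = (\<integral>y. heat_kernel \<tau> (x - y) *\<^sub>R f (l *\<^sub>R y) \<partial>lborel)"
    using l False
    by (simp add: heat_kernel_scaleR flip: scaleR_diff_right integral_scaleR_right)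
  finally show ?thesis using False by (simp add: heat_def)
qed

section \<open>Weakly solenoidal fields\<close>

lemma testfn_lipschitz:
  fixes F :: "vec3 \<Rightarrow> real"
  assumes F: "testfn F"
  obtains L where "L \<ge> 0" "\<And>x y. \<bar>F x - F y\<bar> \<le> L * norm (x - y)"
proof -
  obtain M where M: "M > 0" "\<And>x i. norm (pd i F x) \<le> M"
    using testfn_bounds[OF F] by metis
  show thesis
  proof (rule that[of "3 * M"])
    fix x y
    have "norm (F x - F y) \<le> (3 * M) * norm (x - y)"
    proof (rule differentiable_bound[of UNIV])
      show "(F has_derivative (\<lambda>h. \<Sum>i\<in>UNIV. h $ i *\<^sub>R pd i F z)) (at z within UNIV)" for z
        using F has_derivative_pd[of F z] by (simp add: testfn_def)
      show "onorm (\<lambda>h. \<Sum>i\<in>UNIV. h $ i *\<^sub>R pd i F z) \<le> 3 * M" for z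
      proof (rule onorm_le)
        fix h :: vec3
        have "norm (\<Sum>i\<in>UNIV. h $ i *\<^sub>R pd i F z) \<le> (\<Sum>i\<in>(UNIV::3 set). norm h * M)"
          by (rule sum_norm_le) (use M component_le_norm_cart in \<open>auto simp: abs_mult intro!: mult_mono\<close>)
        then show "norm (\<Sum>i\<in>UNIV. h $ i *\<^sub>R pd i F z) \<le> 3 * M * norm h" by (simp add: mult_ac)
      qed
    qed auto
    then show "\<bar>F x - F y\<bar> \<le> 3 * M * norm (x - y)" by simp
  qed (use M in simp)
qed

text \<open>The difference quotients have integral zero by translation invariance of the measure.\<close>

lemma testfn_integral_pd:
  fixes F :: "vec3 \<Rightarrow> real"
  assumes F: "testfn F"
  shows "(\<integral>x. pd i F x \<partial>lborel) = 0"
proof -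
  obtain L where L: "L \<ge> 0" "\<And>x y. \<bar>F x - F y\<bar> \<le> L * norm (x - y)"
    using testfn_lipschitz[OF F] by blast
  obtain R where R: "\<And>x. norm x > R \<Longrightarrow> F x = 0"
    using testfn_support[OF F] by metis
  have [measurable]: "F \<in> borel_measurable borel" "pd i F \<in> borel_measurable borel"
    using F testfn_continuous[OF F] by (auto simp: testfn_def intro: borel_measurable_continuous_onI)
  define t where "t n = 1 / real (Suc n)" for n
  have t0: "t n > 0" "t n \<le> 1" for n by (auto simp: t_def)
  let ?v = "axis i 1 :: vec3"
  let ?q = "\<lambda>n x. (F (x + t n *\<^sub>R ?v) - F x) / t n"
  have "(\<lambda>n. \<integral>x. ?q n x \<partial>lborel) \<longlonglongrightarrow> (\<integral>x. pd i F x \<partial>lborel)"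
  \<comment> \<open>Steps of length at most 1 keep every difference quotient supported in the ball
    of radius \<open>R + 1\<close>, and the Lipschitz constant bounds it there.\<close>
  proof (rule integral_dominated_convergence[where w = "\<lambda>x. indicator (cball 0 (R + 1)) x *\<^sub>R L"])
    show "integrable lborel (\<lambda>x::vec3. indicator (cball 0 (R + 1)) x *\<^sub>R L)"
      by (intro integrable_scaleR_left integrable_real_indicator)
         (use emeasure_lborel_cball_finite[of "0::vec3" "R + 1"] in auto)
    show "AE x in lborel. (\<lambda>n. ?q n x) \<longlonglongrightarrow> pd i F x"
    proof (intro AE_I2)
      fix x
      have d: "(F has_derivative frechet_derivative F (at x)) (at x)"
        using F frechet_derivative_works by (auto simp: testfn_def)
      have "((\<lambda>s. x + s *\<^sub>R ?v) has_derivative (\<lambda>s. s *\<^sub>R ?v)) (at 0)"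
        by (auto intro!: derivative_eq_intros)
      then have "((\<lambda>s. F (x + s *\<^sub>R ?v)) has_derivative (\<lambda>s. frechet_derivative F (at x) (s *\<^sub>R ?v))) (at 0)"
        by (rule has_derivative_compose) (use d in simp)
      then have "((\<lambda>s. F (x + s *\<^sub>R ?v)) has_real_derivative pd i F x) (at 0)"
        using linear_cmul[OF linear_frechet_derivative[of F "at x"]] F
        by (simp add: has_field_derivative_def pd_def testfn_def mult_commute_abs)
      then have "((\<lambda>s. (F (x + s *\<^sub>R ?v) - F x) / s) \<longlongrightarrow> pd i F x) (at 0)"
        by (simp add: DERIV_def)
      moreover have "t \<longlonglongrightarrow> 0" unfolding t_def by (rule LIMSEQ_Suc[OF lim_1_over_n])
      moreover have "t n \<in> UNIV - {0}" for n using t0(1)[of n] by simp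
      ultimately show "(\<lambda>n. ?q n x) \<longlonglongrightarrow> pd i F x"
        unfolding tendsto_at_iff_sequentially by (auto simp: o_def)
    qed
    show "AE x in lborel. norm (?q n x) \<le> indicator (cball 0 (R + 1)) x *\<^sub>R L" for n
    proof (intro AE_I2)
      fix x
      show "norm (?q n x) \<le> indicator (cball 0 (R + 1)) x *\<^sub>R L"
      proof (cases "norm x \<le> R + 1")
        case True
        have "\<bar>F (x + t n *\<^sub>R ?v) - F x\<bar> \<le> L * t n"
          using L(2)[of "x + t n *\<^sub>R ?v" x] t0[of n] by (simp add: norm_axis_1)
        with True t0[of n] show ?thesis by (simp add: field_simps)
      next
        case False
        have "norm x \<le> norm (x + t n *\<^sub>R ?v) + norm (t n *\<^sub>R ?v)"
          by (metis add_diff_cancel_right' norm_triangle_ineq4)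
        then have "norm (x + t n *\<^sub>R ?v) > R" using False t0[of n] by (simp add: norm_axis_1)
        then show ?thesis using R False by simp
      qed
    qed
  qed (auto)
  moreover have "(\<integral>x. ?q n x \<partial>lborel) = 0" for n
  proof -
    have 1: "integrable lborel F" by (rule testfn_integrable[OF F])
    have 2: "integrable lborel (\<lambda>x. F (x + t n *\<^sub>R ?v))"
      using 1 by (rule lborel_integrable_shift)
    show ?thesis using 1 2 by (simp add: lborel_integral_shift)
  qed
  ultimately have "(\<lambda>_::nat. 0) \<longlonglongrightarrow> (\<integral>x. pd i F x \<partial>lborel)" by (simp only:)
  then show ?thesis by (rule LIMSEQ_unique[OF _ tendsto_const])
qed

lemma pd_mult:
  fixes f g :: "vec3 \<Rightarrow> real"
  assumes "f differentiable (at x)" "g differentiable (at x)"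
  shows "(\<lambda>x. f x * g x) differentiable (at x)"
    "pd i (\<lambda>x. f x * g x) x = f x * pd i g x + pd i f x * g x"
proof -
  let ?F = "frechet_derivative f (at x)" and ?G = "frechet_derivative g (at x)"
  have "((\<lambda>x. f x * g x) has_derivative (\<lambda>h. f x * ?G h + ?F h * g x)) (at x)"
    using assms by (intro has_derivative_mult) (simp_all add: frechet_derivative_works)
  from differentiableI[OF this] pd_eqI[OF this]
  show "(\<lambda>x. f x * g x) differentiable (at x)"
    "pd i (\<lambda>x. f x * g x) x = f x * pd i g x + pd i f x * g x"
    by (simp_all add: pd_def)
qed

lemma testfn_mult:
  fixes f g :: "vec3 \<Rightarrow> real"
  assumes f: "\<And>x. f differentiable (at x)" "\<And>i. continuous_on UNIV (pd i f)" and g: "testfn g"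
  shows "testfn (\<lambda>x. f x * g x)"
  unfolding testfn_def
proof (intro conjI allI)
  have g': "g differentiable (at x)" "continuous_on UNIV (pd i g)" for x i using g by (auto simp: testfn_def)
  show "(\<lambda>x. f x * g x) differentiable (at x)" for x by (rule pd_mult[OF f(1) g'(1)])
  have cf: "continuous_on UNIV f" by (simp add: f differentiable_imp_continuous_on differentiable_on_def)
  have "pd i (\<lambda>x. f x * g x) = (\<lambda>x. f x * pd i g x + pd i f x * g x)" for i
    by (rule ext) (rule pd_mult[OF f(1) g'(1)])
  moreover have "continuous_on UNIV (\<lambda>x. f x * pd i g x + pd i f x * g x)" for i
    using cf f(2) g'(2) testfn_continuous[OF g] by (intro continuous_on_add continuous_on_mult)
  ultimately show "continuous_on UNIV (pd i (\<lambda>x. f x * g x))" for i by simp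
  show "bounded {x. f x * g x \<noteq> 0}"
    by (rule bounded_subset[of "{x. g x \<noteq> 0}"]) (use g in \<open>auto simp: testfn_def\<close>)
qed

text \<open>Zero divergence turns the pairing of \<open>V\<close> with the gradient of
  \<open>\<psi>\<close> into the divergence of the product. Its components are compactly supported
  test functions, whose derivatives integrate to zero.\<close>

lemma divg_0_imp_divfree:
  fixes V :: field3
  assumes V: "\<And>x. V differentiable (at x)" "\<And>i. continuous_on UNIV (pd i V)" "\<And>x. divg V x = 0"
  shows "divfree V"
  unfolding divfree_def
proof (intro allI impI)
  fix \<psi> :: "vec3 \<Rightarrow> real" assume \<psi>: "testfn \<psi>"
  have comp: "(\<lambda>x. V x $ i) differentiable (at x)" "pd j (\<lambda>x. V x $ i) x = pd j V x $ i" for i j x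
  proof -
    have "(V has_derivative frechet_derivative V (at x)) (at x)"
      using V(1) frechet_derivative_works by blast
    from bounded_linear.has_derivative[OF bounded_linear_vec_nth this, of i]
    have *: "((\<lambda>x. V x $ i) has_derivative (\<lambda>h. frechet_derivative V (at x) h $ i)) (at x)" .
    show "(\<lambda>x. V x $ i) differentiable (at x)" using * by (rule differentiableI)
    show "pd j (\<lambda>x. V x $ i) x = pd j V x $ i" using pd_eqI[OF *] by (simp add: pd_def)
  qed
  have cont: "continuous_on UNIV (pd j (\<lambda>x. V x $ i))" for i j
  proof -
    have "pd j (\<lambda>x. V x $ i) = (\<lambda>x. pd j V x $ i)" by (rule ext) (rule comp)
    then show ?thesis using V(2) by (simp add: continuous_on_component)
  qed
  have t: "testfn (\<lambda>x. V x $ i * \<psi> x)" for i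
    by (rule testfn_mult[OF comp(1) cont \<psi>])
  have "(\<Sum>i\<in>UNIV. V x $ i * pd i \<psi> x) = (\<Sum>i\<in>UNIV. pd i (\<lambda>x. V x $ i * \<psi> x) x)" for x
  proof -
    have "pd i (\<lambda>x. V x $ i * \<psi> x) x = V x $ i * pd i \<psi> x + pd i V x $ i * \<psi> x" for i
      using pd_mult(2)[OF comp(1), of \<psi> x i] \<psi> comp(2) by (simp add: testfn_def)
    then show ?thesis
      using V(3)[of x] by (simp add: sum.distrib divg_def flip: sum_distrib_right)
  qed
  then have "(\<integral>x. (\<Sum>i\<in>UNIV. V x $ i * pd i \<psi> x) \<partial>lborel)
      = (\<Sum>i\<in>UNIV. \<integral>x. pd i (\<lambda>x. V x $ i * \<psi> x) x \<partial>lborel)"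
    using testfn_integrable(2)[OF t] by simp
  then show "(\<integral>x. (\<Sum>i\<in>UNIV. V x $ i * pd i \<psi> x) \<partial>lborel) = 0"
    using testfn_integral_pd[OF t] by simp
qed

text \<open>Dyadic covering: a point of the n-th shell lies in \<open>?A n\<close> and satisfies
  1/|x| \<le> 2^(n+1)/R. The ball volumes contribute 8^(-n) against this 2^n, which leaves a
  geometric series of ratio 1/4.\<close>

lemma integrable_inverse_norm:
  "integrable lborel (\<lambda>x::vec3. indicator (ball 0 R) x / norm x)"
proof (rule integrableI_bounded)
  let ?A = "\<lambda>n. ball (0::vec3) (\<bar>R\<bar> / 2 ^ n)"
  let ?c = "unit_ball_vol 3"
  show "(\<lambda>x::vec3. indicator (ball 0 R) x / norm x) \<in> borel_measurable lborel"
  proof -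
    have "(\<lambda>x::vec3. norm x) \<in> borel_measurable borel" by (intro borel_measurable_continuous_onI continuous_intros)
    then show ?thesis by (intro borel_measurable_divide borel_measurable_indicator) simp_all
  qed
  have c: "?c \<ge> 0" by simp
  have le: "a n \<le> suminf a" for a :: "nat \<Rightarrow> ennreal" and n
    using sum_le_suminf[of a "{n}"] by simp
  have "(\<integral>\<^sup>+x. ennreal (norm (indicator (ball 0 R) x / norm (x::vec3))) \<partial>lborel)
     \<le> (\<integral>\<^sup>+x. (\<Sum>n. ennreal (2 ^ Suc n / \<bar>R\<bar>) * indicator (?A n) x) \<partial>lborel)"
  proof (rule nn_integral_mono)
    fix x :: vec3
    show "ennreal (norm (indicator (ball 0 R) x / norm x)) \<le> (\<Sum>n. ennreal (2 ^ Suc n / \<bar>R\<bar>) * indicator (?A n) x)"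
    proof (cases "x = 0 \<or> norm x \<ge> R")
      case True
      then show ?thesis by (auto simp: indicator_def)
    next
      case False
      then have x: "norm x > 0" "norm x < R" by auto
      then have R: "R > 0" by linarith
      obtain m where "R / norm x < 2 ^ m" using real_arch_pow[of 2 "R / norm x"] by auto
      then have ex: "\<exists>m. R / norm x \<le> 2 ^ m" using less_imp_le by blast
      \<comment> \<open>The least exponent is positive since |x| < R, so it has a predecessor
        \<open>n\<close>. Minimality places \<open>x\<close> in \<open>?A n\<close>, while
        \<open>k\<close> itself bounds 1/|x|.\<close>
      define k where "k = (LEAST m. R / norm x \<le> 2 ^ m)"
      have k: "R / norm x \<le> 2 ^ k" unfolding k_def by (rule LeastI_ex[OF ex])
      have "k \<noteq> 0" using k x by (auto simp: field_simps intro: ccontr)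
      then obtain n where n: "k = Suc n" by (cases k) auto
      have "\<not> R / norm x \<le> 2 ^ n" using not_less_Least[of n "\<lambda>m. R / norm x \<le> 2 ^ m"] n by (simp add: k_def)
      then have "norm x < R / 2 ^ n" using x by (simp add: field_simps)
      then have mem: "x \<in> ?A n" using R by simp
      have "norm (indicator (ball 0 R) x / norm x) \<le> 2 ^ Suc n / \<bar>R\<bar>"
        using k x R unfolding n by (simp add: field_simps)
      then have "ennreal (norm (indicator (ball 0 R) x / norm x)) \<le> ennreal (2 ^ Suc n / \<bar>R\<bar>) * indicator (?A n) x"
        using mem by (simp add: ennreal_leI)
      also have "\<dots> \<le> (\<Sum>n. ennreal (2 ^ Suc n / \<bar>R\<bar>) * indicator (?A n) x)"
        by (rule le)
      finally show ?thesis .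
    qed
  qed
  also have "\<dots> = (\<Sum>n. \<integral>\<^sup>+x. ennreal (2 ^ Suc n / \<bar>R\<bar>) * indicator (?A n) x \<partial>lborel)"
    by (rule nn_integral_suminf) (auto intro!: borel_measurable_times_ennreal borel_measurable_indicator)
  also have "\<dots> \<le> (\<Sum>n. ennreal (2 * ?c * R\<^sup>2 * (1/4) ^ n))"
  proof (intro suminf_le)
    fix n
    have "(\<integral>\<^sup>+x. ennreal (2 ^ Suc n / \<bar>R\<bar>) * indicator (?A n) x \<partial>lborel)
        = ennreal (2 ^ Suc n / \<bar>R\<bar>) * ennreal (?c * (\<bar>R\<bar> / 2 ^ n) ^ 3)"
      by (subst nn_integral_cmult_indicator) (auto simp: emeasure_ball)
    also have "\<dots> = ennreal (2 ^ Suc n / \<bar>R\<bar> * (?c * (\<bar>R\<bar> / 2 ^ n) ^ 3))"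
      by (rule ennreal_mult[symmetric]) (auto intro!: mult_nonneg_nonneg c)
    also have "2 ^ Suc n / \<bar>R\<bar> * (?c * (\<bar>R\<bar> / 2 ^ n) ^ 3) = 2 * ?c * R\<^sup>2 * (1/4) ^ n"
    proof (cases "R = 0")
      case False
      have "(4::real) ^ n = 2 ^ n * 2 ^ n" by (simp flip: power_mult_distrib)
      with False show ?thesis by (simp add: field_simps power2_eq_square power3_eq_cube power_divide)
    qed simp
    finally show "(\<integral>\<^sup>+x. ennreal (2 ^ Suc n / \<bar>R\<bar>) * indicator (?A n) x \<partial>lborel) \<le> ennreal (2 * ?c * R\<^sup>2 * (1/4) ^ n)"
      by simp
  qed auto
  also have "\<dots> = ennreal (\<Sum>n. 2 * ?c * R\<^sup>2 * (1/4) ^ n)"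
    by (rule suminf_ennreal2) (auto intro!: summable_mult summable_geometric mult_nonneg_nonneg c)
  also have "\<dots> < \<infinity>" by simp
  finally show "(\<integral>\<^sup>+x. ennreal (norm (indicator (ball 0 R) x / norm (x::vec3))) \<partial>lborel) < \<infinity>" .
qed

text \<open>The common bound \<open>C / norm x\<close> is integrable against a bounded gradient of
  compact support, so the weak identity survives by dominated convergence. This replaces the
  excision of a small ball around the singularity and the surface integrals that go with it.\<close>

lemma divfree_limit:
  fixes V :: "nat \<Rightarrow> field3" and f :: field3
  assumes V: "\<And>n. divfree (V n)" "\<And>n. V n \<in> borel_measurable borel"
    and bound: "\<And>n x. x \<noteq> 0 \<Longrightarrow> norm (V n x) \<le> C / norm x"
    and lim: "\<And>x. x \<noteq> 0 \<Longrightarrow> (\<lambda>n. V n x) \<longlonglongrightarrow> f x"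
    and f: "f \<in> borel_measurable borel"
  shows "divfree f"
  unfolding divfree_def
proof (intro allI impI)
  fix \<psi> :: "vec3 \<Rightarrow> real" assume \<psi>: "testfn \<psi>"
  obtain R M where M: "M > 0" "\<And>x i. norm x > R \<Longrightarrow> pd i \<psi> x = 0" "\<And>x i. norm (pd i \<psi> x) \<le> M"
    using testfn_bounds[OF \<psi>] by metis
  note [measurable] = f V(2)
  have [measurable]: "pd i \<psi> \<in> borel_measurable borel" for i
    using \<psi> by (auto simp: testfn_def intro: borel_measurable_continuous_onI)
  have [measurable]: "(\<lambda>x. g x $ i) \<in> borel_measurable borel" if "g \<in> borel_measurable borel" for g :: field3 and i
    using that by (rule measurable_compose) (intro borel_measurable_continuous_onI continuous_intros)
  have "(\<lambda>n. \<integral>x. (\<Sum>i\<in>UNIV. V n x $ i * pd i \<psi> x) \<partial>lborel) \<longlonglongrightarrow> (\<integral>x. (\<Sum>i\<in>UNIV. f x $ i * pd i \<psi> x) \<partial>lborel)"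
  proof (rule integral_dominated_convergence[where w = "\<lambda>x. 3 * C * M * (indicator (ball 0 (R + 1)) x / norm x)"])
    show "integrable lborel (\<lambda>x::vec3. 3 * C * M * (indicator (ball 0 (R + 1)) x / norm x))"
      by (intro integrable_mult_right integrable_inverse_norm)
    show "AE x in lborel. (\<lambda>n. \<Sum>i\<in>UNIV. V n x $ i * pd i \<psi> x) \<longlonglongrightarrow> (\<Sum>i\<in>UNIV. f x $ i * pd i \<psi> x)"
      using AE_lborel_singleton[of 0]
      by eventually_elim (intro tendsto_intros lim)
    show "AE x in lborel. norm (\<Sum>i\<in>UNIV. V n x $ i * pd i \<psi> x) \<le> 3 * C * M * (indicator (ball 0 (R + 1)) x / norm x)" for n
      using AE_lborel_singleton[of 0]
    proof eventually_elim
      fix x :: vec3 assume "x \<noteq> 0"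
      note bound = bound[OF this]
      show "norm (\<Sum>i\<in>UNIV. V n x $ i * pd i \<psi> x) \<le> 3 * C * M * (indicator (ball 0 (R + 1)) x / norm x)"
      proof (cases "norm x > R")
        case True
        have "0 \<le> C / norm x" using bound[of n] norm_ge_zero order_trans by blast
        then have "0 \<le> C / norm x * (3 * M)" using M(1) by (intro mult_nonneg_nonneg) auto
        with True M(2) show ?thesis by (simp add: indicator_def mult_ac)
      next
        case False
        have "norm (\<Sum>i\<in>UNIV. V n x $ i * pd i \<psi> x) \<le> (\<Sum>i\<in>(UNIV::3 set). C / norm x * M)"
        proof (rule sum_norm_le)
          fix i
          have "\<bar>V n x $ i\<bar> \<le> C / norm x" using component_le_norm_cart bound order_trans by blast
          then show "norm (V n x $ i * pd i \<psi> x) \<le> C / norm x * M"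
            unfolding norm_mult using M(3)[of i x] M(1) by (intro mult_mono) auto
        qed
        then show ?thesis using False by (simp add: indicator_def mult_ac)
      qed
    qed
  qed auto
  moreover have "(\<integral>x. (\<Sum>i\<in>UNIV. V n x $ i * pd i \<psi> x) \<partial>lborel) = 0" for n
    using V(1) \<psi> by (simp add: divfree_def)
  ultimately have "(\<lambda>_::nat. 0) \<longlonglongrightarrow> (\<integral>x. (\<Sum>i\<in>UNIV. f x $ i * pd i \<psi> x) \<partial>lborel)" by (simp only:)
  then show "(\<integral>x. (\<Sum>i\<in>UNIV. f x $ i * pd i \<psi> x) \<partial>lborel) = 0"
    by (rule LIMSEQ_unique[OF _ tendsto_const])
qed

section \<open>The Landau family\<close>

text \<open>The derivative is the sum of two rank-one maps and a multiple of the identity in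
  dimension three; the divergence is its trace.\<close>

lemma linear_field_derivative:
  fixes e :: vec3
  assumes A: "(\<alpha> has_derivative \<alpha>') (at x)" and B: "(\<beta> has_derivative \<beta>') (at x)"
  shows "(\<lambda>x. \<alpha> x *\<^sub>R e + \<beta> x *\<^sub>R x) differentiable (at x)"
    "pd i (\<lambda>x. \<alpha> x *\<^sub>R e + \<beta> x *\<^sub>R x) x = \<alpha>' (axis i 1) *\<^sub>R e + \<beta>' (axis i 1) *\<^sub>R x + \<beta> x *\<^sub>R axis i 1"
    "divg (\<lambda>x. \<alpha> x *\<^sub>R e + \<beta> x *\<^sub>R x) x = \<alpha>' e + \<beta>' x + 3 * \<beta> x"
proof -
  have d: "((\<lambda>x. \<alpha> x *\<^sub>R e + \<beta> x *\<^sub>R x) has_derivative (\<lambda>h. \<alpha>' h *\<^sub>R e + \<beta>' h *\<^sub>R x + \<beta> x *\<^sub>R h)) (at x)"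
    using A B by (auto intro!: derivative_eq_intros)
  show "(\<lambda>x. \<alpha> x *\<^sub>R e + \<beta> x *\<^sub>R x) differentiable (at x)" using d by (rule differentiableI)
  show pd: "pd i (\<lambda>x. \<alpha> x *\<^sub>R e + \<beta> x *\<^sub>R x) x = \<alpha>' (axis i 1) *\<^sub>R e + \<beta>' (axis i 1) *\<^sub>R x + \<beta> x *\<^sub>R axis i 1" for i
    using pd_eqI[OF d] .
  interpret A: bounded_linear \<alpha>' using A by (rule has_derivative_bounded_linear)
  interpret B: bounded_linear \<beta>' using B by (rule has_derivative_bounded_linear)
  have ex: "L v = (\<Sum>i\<in>UNIV. L (axis i 1) * v $ i)" if "bounded_linear L" for L :: "vec3 \<Rightarrow> real" and v
  proof -
    interpret L: bounded_linear L by (rule that)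
    have "L v = L (\<Sum>i\<in>UNIV. v $ i *\<^sub>R axis i 1)"
      using basis_expansion[of v] by (simp add: scalar_mult_eq_scaleR)
    then show ?thesis by (simp add: L.sum L.scaleR mult.commute)
  qed
  show "divg (\<lambda>x. \<alpha> x *\<^sub>R e + \<beta> x *\<^sub>R x) x = \<alpha>' e + \<beta>' x + 3 * \<beta> x"
    unfolding divg_def pd ex[OF A.bounded_linear_axioms, of e] ex[OF B.bounded_linear_axioms, of x]
    by (simp add: sum.distrib)
qed

text \<open>Cauchy-Schwarz bounds \<open>x \<bullet> e\<close> by \<open>R\<close>, and |a| > 1
  leaves a gap. \<open>R\<close> may exceed \<open>norm x\<close>, so the same estimate serves the
  regularised radius with a constant independent of the regularisation.\<close>

lemma landau_denominator:
  fixes e x :: vec3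
  assumes a: "\<bar>a\<bar> > 1" and e: "norm e = 1" and R: "norm x \<le> R"
  shows "\<bar>a * R - x \<bullet> e\<bar> \<ge> (\<bar>a\<bar> - 1) * R"
proof -
  have "\<bar>x \<bullet> e\<bar> \<le> R" using Cauchy_Schwarz_ineq2[of x e] e R by simp
  moreover have "R \<ge> 0" using R norm_ge_zero order_trans by blast
  then have "\<bar>a * R\<bar> = \<bar>a\<bar> * R" by (simp add: abs_mult)
  ultimately show ?thesis by (simp add: algebra_simps)
qed

text \<open>The Landau field is the curl of \<open>(2 / (a r - z)) e \<times> x\<close> with \<open>r = |x|\<close> and \<open>z = x \<bullet> e\<close>.
  Replacing \<open>r\<close> by \<open>sqrt (r\<^sup>2 + d\<^sup>2)\<close> in this vector potential gives the following smooth solenoidal field.\<close>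

definition landau_reg :: "real \<Rightarrow> vec3 \<Rightarrow> real \<Rightarrow> field3" where
  "landau_reg a e d x = (let R = sqrt (x \<bullet> x + d\<^sup>2); D = a * R - x \<bullet> e in
     (2 * inverse D + 2 * a * d\<^sup>2 * (inverse R * (inverse D)\<^sup>2)) *\<^sub>R e
     + (2 * a * (x \<bullet> e) * (inverse R * (inverse D)\<^sup>2) - 2 * (inverse D)\<^sup>2) *\<^sub>R x)"

text \<open>Being a curl explains the zero divergence; the verification differentiates the
  coefficients \<open>\<alpha>\<close> of \<open>e\<close> and \<open>\<beta>\<close> of
  \<open>x\<close> directly. Since \<open>d > 0\<close>, the radius \<open>R\<close> is positive
  everywhere, hence \<open>D\<close> never vanishes and all coefficients are C^1 across the
  origin.\<close>

lemma divfree_landau_reg: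
  assumes a: "\<bar>a\<bar> > 1" and e: "norm e = 1" and d: "d > 0"
  shows "divfree (landau_reg a e d)" "continuous_on UNIV (landau_reg a e d)"
proof -
  define R :: "vec3 \<Rightarrow> real" where "R x = sqrt (x \<bullet> x + d\<^sup>2)" for x
  define D where "D x = a * R x - x \<bullet> e" for x
  define p where "p x = inverse (R x)" for x
  define q where "q x = inverse (D x)" for x
  define w where "w x = p x * (q x)\<^sup>2" for x
  define R' where "R' x h = (x \<bullet> h) * p x" for x h
  define D' where "D' x h = a * R' x h - h \<bullet> e" for x h
  define p' where "p' x h = - (p x)\<^sup>2 * R' x h" for x h
  define q' where "q' x h = - (q x)\<^sup>2 * D' x h" for x h
  define w' where "w' x h = p' x h * (q x)\<^sup>2 + p x * (2 * q x * q' x h)" for x h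
  define \<alpha> where "\<alpha> x = 2 * q x + 2 * a * d\<^sup>2 * w x" for x
  define \<beta> where "\<beta> x = 2 * a * (x \<bullet> e) * w x - 2 * (q x)\<^sup>2" for x
  define \<alpha>' where "\<alpha>' x h = 2 * q' x h + 2 * a * d\<^sup>2 * w' x h" for x h
  define \<beta>' where "\<beta>' x h = 2 * a * (h \<bullet> e) * w x + 2 * a * (x \<bullet> e) * w' x h - 4 * q x * q' x h" for x h
  have V: "landau_reg a e d = (\<lambda>x. \<alpha> x *\<^sub>R e + \<beta> x *\<^sub>R x)"
    by (simp add: fun_eq_iff landau_reg_def Let_def \<alpha>_def \<beta>_def w_def p_def q_def D_def R_def)
  have pos: "x \<bullet> x + d\<^sup>2 > 0" for x :: vec3 using d by (simp add: add_nonneg_pos)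
  have R0: "R x > 0" for x using pos by (simp add: R_def)
  have RR: "x \<bullet> x = R x * R x - d\<^sup>2" for x using pos[of x] by (simp add: R_def)
  have nR: "norm x \<le> R x" for x by (simp add: R_def norm_eq_sqrt_inner)
  have D0: "D x \<noteq> 0" for x
    using landau_denominator[OF a e nR[of x]] a R0[of x] unfolding D_def by (smt (verit) mult_pos_pos)
  have dR: "(R has_derivative R' x) (at x)" for x
    unfolding R_def[abs_def] R'_def[abs_def] p_def using pos[of x]
    by (auto intro!: derivative_eq_intros simp: fun_eq_iff R_def inner_commute)
  have dD: "(D has_derivative D' x) (at x)" for x
    unfolding D_def[abs_def] D'_def[abs_def] by (auto intro!: derivative_eq_intros dR)
  have dp: "(p has_derivative p' x) (at x)" for x
    unfolding p_def[abs_def] p'_def[abs_def]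
    by (rule has_derivative_eq_rhs[OF Deriv.has_derivative_inverse[OF _ dR]])
       (use R0[of x] in \<open>auto simp: fun_eq_iff power2_eq_square\<close>)
  have dq: "(q has_derivative q' x) (at x)" for x
    unfolding q_def[abs_def] q'_def[abs_def]
    by (rule has_derivative_eq_rhs[OF Deriv.has_derivative_inverse[OF _ dD]])
       (use D0[of x] in \<open>auto simp: fun_eq_iff power2_eq_square\<close>)
  have dw: "(w has_derivative w' x) (at x)" for x
    unfolding w_def[abs_def] w'_def[abs_def] by (auto intro!: derivative_eq_intros dp dq simp: fun_eq_iff algebra_simps)
  have d\<alpha>: "(\<alpha> has_derivative \<alpha>' x) (at x)" for x
    unfolding \<alpha>_def[abs_def] \<alpha>'_def[abs_def] by (auto intro!: derivative_eq_intros dq dw)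
  have d\<beta>: "(\<beta> has_derivative \<beta>' x) (at x)" for x
    unfolding \<beta>_def[abs_def] \<beta>'_def[abs_def]
    by (auto intro!: derivative_eq_intros dq dw simp: fun_eq_iff algebra_simps)
  have cR: "continuous_on UNIV R" unfolding R_def[abs_def] by (intro continuous_intros)
  have cp: "continuous_on UNIV p" unfolding p_def[abs_def]
    by (intro continuous_on_inverse cR) (use R0 in \<open>auto simp: less_le\<close>)
  have cD: "continuous_on UNIV D" unfolding D_def[abs_def] by (intro continuous_intros cR)
  have cq: "continuous_on UNIV q" unfolding q_def[abs_def]
    by (intro continuous_on_inverse cD) (use D0 in auto)
  have cw: "continuous_on UNIV w" unfolding w_def[abs_def] by (intro continuous_intros cp cq)
  have c\<beta>: "continuous_on UNIV \<beta>" unfolding \<beta>_def[abs_def] by (intro continuous_intros cq cw)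
  have c\<alpha>: "continuous_on UNIV \<alpha>" unfolding \<alpha>_def[abs_def] by (intro continuous_intros cq cw)
  have cq': "continuous_on UNIV (\<lambda>x. q' x h)" for h
    unfolding q'_def D'_def R'_def by (intro continuous_intros cp cq)
  have cw': "continuous_on UNIV (\<lambda>x. w' x h)" for h
    unfolding w'_def p'_def R'_def by (intro continuous_intros cp cq cq')
  have c\<alpha>': "continuous_on UNIV (\<lambda>x. \<alpha>' x h)" for h
    unfolding \<alpha>'_def by (intro continuous_intros cq' cw')
  have c\<beta>': "continuous_on UNIV (\<lambda>x. \<beta>' x h)" for h
    unfolding \<beta>'_def by (intro continuous_intros cw cq cq' cw')
  show "continuous_on UNIV (landau_reg a e d)"
    unfolding V by (intro continuous_intros c\<alpha> c\<beta>)
  show "divfree (landau_reg a e d)"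
    unfolding V
  proof (rule divg_0_imp_divfree)
    show "(\<lambda>x. \<alpha> x *\<^sub>R e + \<beta> x *\<^sub>R x) differentiable (at x)" for x
      by (rule linear_field_derivative[OF d\<alpha> d\<beta>])
    have "pd i (\<lambda>x. \<alpha> x *\<^sub>R e + \<beta> x *\<^sub>R x)
       = (\<lambda>x. \<alpha>' x (axis i 1) *\<^sub>R e + \<beta>' x (axis i 1) *\<^sub>R x + \<beta> x *\<^sub>R axis i 1)" for i
      by (rule ext) (rule linear_field_derivative[OF d\<alpha> d\<beta>])
    moreover have "continuous_on UNIV (\<lambda>x. \<alpha>' x (axis i 1) *\<^sub>R e + \<beta>' x (axis i 1) *\<^sub>R x + \<beta> x *\<^sub>R axis i 1)" for i
      by (intro continuous_intros c\<alpha>' c\<beta>' c\<beta>)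
    ultimately show "continuous_on UNIV (pd i (\<lambda>x. \<alpha> x *\<^sub>R e + \<beta> x *\<^sub>R x))" for i by simp
    show "divg (\<lambda>x. \<alpha> x *\<^sub>R e + \<beta> x *\<^sub>R x) x = 0" for x
    proof -
      have ee: "e \<bullet> e = 1" using e by (simp add: norm_eq_1)
      \<comment> \<open>Elimination: \<open>x \<bullet> e\<close> and \<open>x \<bullet> x\<close>
        are expressed through \<open>R\<close> and \<open>D\<close>, which then cancel against their
        reciprocals \<open>p\<close> and \<open>q\<close>. The divergence becomes a polynomial in
        \<open>a\<close>, \<open>d\<close>, \<open>p\<close> and \<open>q\<close> that vanishes
        identically.\<close>
      have z: "x \<bullet> e = a * R x - D x" by (simp add: D_def)
      have pR: "p x * R x = 1" using R0[of x] by (simp add: p_def)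
      have qD: "q x * D x = 1" using D0[of x] by (simp add: q_def)
      have Re: "R' x e = a - D x * p x" unfolding R'_def z using pR by algebra
      have Rx: "R' x x = R x - d\<^sup>2 * p x" unfolding R'_def RR[of x] using pR by algebra
      have De: "D' x e = a\<^sup>2 - 1 - a * D x * p x" unfolding D'_def Re ee by (simp add: algebra_simps power2_eq_square)
      have Dx: "D' x x = D x - a * d\<^sup>2 * p x" unfolding D'_def Rx z by (simp add: algebra_simps)
      have qe: "q' x e = a * p x * q x - (q x)\<^sup>2 * (a\<^sup>2 - 1)" unfolding q'_def De using qD by algebra
      have qx: "q' x x = a * d\<^sup>2 * p x * (q x)\<^sup>2 - q x" unfolding q'_def Dx using qD by algebra
      have pe: "p' x e = D x * p x ^ 3 - a * (p x)\<^sup>2" unfolding p'_def Re by algebra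
      have px: "p' x x = d\<^sup>2 * p x ^ 3 - p x" unfolding p'_def Rx using pR by algebra
      have we: "w' x e = a * (p x)\<^sup>2 * (q x)\<^sup>2 + p x ^ 3 * q x - 2 * p x * q x ^ 3 * (a\<^sup>2 - 1)"
        unfolding w'_def pe qe using qD by algebra
      have wx: "w' x x = d\<^sup>2 * p x ^ 3 * (q x)\<^sup>2 + 2 * a * d\<^sup>2 * (p x)\<^sup>2 * q x ^ 3 - 3 * p x * (q x)\<^sup>2"
        unfolding w'_def px qx by algebra
      have zw: "(x \<bullet> e) * w x = a * (q x)\<^sup>2 - p x * q x"
        unfolding z w_def using pR qD by algebra
      have zwx: "(x \<bullet> e) * w' x x = 2 * a\<^sup>2 * d\<^sup>2 * p x * q x ^ 3 + 3 * p x * q x - 3 * a * (q x)\<^sup>2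
          - a * d\<^sup>2 * (p x)\<^sup>2 * (q x)\<^sup>2 - d\<^sup>2 * p x ^ 3 * q x"
        unfolding z wx using pR qD by algebra
      have "\<alpha>' x e = 2 * q' x e + 2 * a * d\<^sup>2 * w' x e" by (simp add: \<alpha>'_def)
      moreover have "\<beta>' x x = 2 * a * ((x \<bullet> e) * w x) + 2 * a * ((x \<bullet> e) * w' x x) - 4 * q x * q' x x"
        by (simp add: \<beta>'_def)
      moreover have "\<beta> x = 2 * a * ((x \<bullet> e) * w x) - 2 * (q x)\<^sup>2" by (simp add: \<beta>_def)
      ultimately have "\<alpha>' x e + \<beta>' x x + 3 * \<beta> x = 0"
        unfolding qe we zw zwx qx by algebra
      then show ?thesis using linear_field_derivative(3)[OF d\<alpha> d\<beta>] by simp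
    qed
  qed
qed

text \<open>With k = |a| - 1 one has |D| \<ge> k R, while \<open>d\<close>, |x|, and |x \<bullet> e|
  are at most \<open>R\<close>. Each of the four terms is therefore a constant over
  \<open>R\<close>, and these constants are the four summands of the bound. They do not involve
  \<open>d\<close>, as domination requires.\<close>

lemma norm_landau_reg_le:
  assumes a: "\<bar>a\<bar> > 1" and e: "norm e = 1" and d: "d > 0" and x: "x \<noteq> 0"
  shows "norm (landau_reg a e d x)
    \<le> (2 / (\<bar>a\<bar> - 1) + 2 * \<bar>a\<bar> / (\<bar>a\<bar> - 1)\<^sup>2 + (2 * \<bar>a\<bar> / (\<bar>a\<bar> - 1)\<^sup>2 + 2 / (\<bar>a\<bar> - 1)\<^sup>2)) / norm x"
proof -
  define k where "k = \<bar>a\<bar> - 1"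
  define R where "R = sqrt (x \<bullet> x + d\<^sup>2)"
  define D where "D = a * R - x \<bullet> e"
  have k: "k > 0" using a by (simp add: k_def)
  have xR: "norm x \<le> R" by (simp add: R_def norm_eq_sqrt_inner)
  have x0: "norm x > 0" using x by simp
  have R: "R > 0" using x0 xR by linarith
  have dR: "d\<^sup>2 \<le> R\<^sup>2" by (simp add: R_def)
  have z: "\<bar>x \<bullet> e\<bar> \<le> R" using Cauchy_Schwarz_ineq2[of x e] e xR by simp
  have kD: "k * R \<le> \<bar>D\<bar>" unfolding k_def D_def by (rule landau_denominator[OF a e xR])
  have D0: "\<bar>D\<bar> > 0" using kD k R by (smt (verit) mult_pos_pos)
  have iD: "\<bar>inverse D\<bar> \<le> 1 / (k * R)"
    using kD k R D0 by (simp add: field_simps)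
  have iD2: "(inverse D)\<^sup>2 \<le> 1 / (k\<^sup>2 * R\<^sup>2)"
    using power_mono[OF iD abs_ge_zero, of 2] unfolding power2_abs by (simp add: power_divide power_mult_distrib)
  have 1: "\<bar>2 * inverse D\<bar> \<le> 2 / k / R"
    using iD by (simp add: abs_mult)
  have 2: "\<bar>2 * a * d\<^sup>2 * (inverse R * (inverse D)\<^sup>2)\<bar> \<le> 2 * \<bar>a\<bar> / k\<^sup>2 / R"
  proof -
    have "\<bar>2 * a * d\<^sup>2 * (inverse R * (inverse D)\<^sup>2)\<bar> = 2 * \<bar>a\<bar> * d\<^sup>2 * (inverse R * (inverse D)\<^sup>2)"
      using R by (simp add: abs_mult)
    also have "\<dots> \<le> 2 * \<bar>a\<bar> * R\<^sup>2 * (inverse R * (1 / (k\<^sup>2 * R\<^sup>2)))"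
      using R dR iD2 by (intro mult_mono) auto
    also have "\<dots> = 2 * \<bar>a\<bar> / k\<^sup>2 / R" using R k by (simp add: field_simps)
    finally show ?thesis .
  qed
  have 3: "\<bar>2 * a * (x \<bullet> e) * (inverse R * (inverse D)\<^sup>2)\<bar> * norm x \<le> 2 * \<bar>a\<bar> / k\<^sup>2 / R"
  proof -
    have "\<bar>2 * a * (x \<bullet> e) * (inverse R * (inverse D)\<^sup>2)\<bar> * norm x
        = 2 * \<bar>a\<bar> * \<bar>x \<bullet> e\<bar> * (inverse R * (inverse D)\<^sup>2) * norm x"
      using R by (simp add: abs_mult)
    also have "\<dots> \<le> 2 * \<bar>a\<bar> * R * (inverse R * (1 / (k\<^sup>2 * R\<^sup>2))) * R"
      using R z iD2 xR by (intro mult_mono) auto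
    also have "\<dots> = 2 * \<bar>a\<bar> / k\<^sup>2 / R" using R k by (simp add: field_simps power2_eq_square)
    finally show ?thesis .
  qed
  have 4: "\<bar>2 * (inverse D)\<^sup>2\<bar> * norm x \<le> 2 / k\<^sup>2 / R"
  proof -
    have "\<bar>2 * (inverse D)\<^sup>2\<bar> * norm x \<le> 2 * (1 / (k\<^sup>2 * R\<^sup>2)) * R"
      using iD2 xR R by (intro mult_mono) auto
    also have "\<dots> = 2 / k\<^sup>2 / R" using R k by (simp add: field_simps power2_eq_square)
    finally show ?thesis .
  qed
  have tri: "norm ((p + q) *\<^sub>R e + (r - s) *\<^sub>R x) \<le> \<bar>p\<bar> + \<bar>q\<bar> + (\<bar>r\<bar> * norm x + \<bar>s\<bar> * norm x)" for p q r s
  proof -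
    have "norm ((p + q) *\<^sub>R e + (r - s) *\<^sub>R x) \<le> \<bar>p + q\<bar> + \<bar>r - s\<bar> * norm x"
      by (rule order_trans[OF norm_triangle_ineq]) (simp add: e)
    also have "\<dots> \<le> (\<bar>p\<bar> + \<bar>q\<bar>) + (\<bar>r\<bar> + \<bar>s\<bar>) * norm x"
      by (intro add_mono mult_right_mono) auto
    finally show ?thesis by (simp add: algebra_simps)
  qed
  have "norm (landau_reg a e d x) \<le> 2 / k / R + 2 * \<bar>a\<bar> / k\<^sup>2 / R + (2 * \<bar>a\<bar> / k\<^sup>2 / R + 2 / k\<^sup>2 / R)"
    unfolding landau_reg_def Let_def R_def[symmetric] D_def[symmetric]
    using tri 1 2 3 4 by (smt (verit))
  also have "\<dots> = (2 / k + 2 * \<bar>a\<bar> / k\<^sup>2 + (2 * \<bar>a\<bar> / k\<^sup>2 + 2 / k\<^sup>2)) / R"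
    by (simp add: add_divide_distrib)
  also have "\<dots> \<le> (2 / k + 2 * \<bar>a\<bar> / k\<^sup>2 + (2 * \<bar>a\<bar> / k\<^sup>2 + 2 / k\<^sup>2)) / norm x"
    using xR x0 R k by (intro divide_left_mono) (auto intro!: add_nonneg_nonneg)
  finally show ?thesis by (simp add: k_def)
qed

text \<open>Away from the origin the limiting denominator is nonzero, so all coefficients converge
  and the term with \<open>d\<^sup>2\<close> disappears. What remains is to match the Cartesian form
  with the spherical one, \<open>c\<close> being the cosine of the polar angle.\<close>

lemma landau_reg_tendsto:
  assumes a: "\<bar>a\<bar> > 1" and e: "norm e = 1" and x: "x \<noteq> 0" and d: "d \<longlonglongrightarrow> 0"
  shows "(\<lambda>n. landau_reg a e (d n) x) \<longlonglongrightarrow> landau a e x"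
proof -
  define r where "r = norm x"
  define c where "c = (x \<bullet> e) / r"
  have r: "r > 0" using x by (simp add: r_def)
  have xe: "x \<bullet> e = c * r" using r by (simp add: c_def)
  have "(\<bar>a\<bar> - 1) * r > 0" using a r by simp
  with landau_denominator[OF a e, of x r] have D0: "a * r - c * r \<noteq> 0" by (auto simp: r_def[symmetric] xe)
  then have ac: "a - c \<noteq> 0" by auto
  have "(\<lambda>n. sqrt (x \<bullet> x + (d n)\<^sup>2)) \<longlonglongrightarrow> sqrt (x \<bullet> x + 0\<^sup>2)"
    by (intro tendsto_intros d)
  then have lR: "(\<lambda>n. sqrt (x \<bullet> x + (d n)\<^sup>2)) \<longlonglongrightarrow> r"
    by (simp add: r_def norm_eq_sqrt_inner)
  have "(\<lambda>n. landau_reg a e (d n) x) \<longlonglongrightarrow>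
     (2 * inverse (a * r - c * r) + 2 * a * 0\<^sup>2 * (inverse r * (inverse (a * r - c * r))\<^sup>2)) *\<^sub>R e
     + (2 * a * (c * r) * (inverse r * (inverse (a * r - c * r))\<^sup>2) - 2 * (inverse (a * r - c * r))\<^sup>2) *\<^sub>R x"
    unfolding landau_reg_def Let_def xe by (intro tendsto_intros lR d) (use D0 r in auto)
  also have "(2 * inverse (a * r - c * r) + 2 * a * 0\<^sup>2 * (inverse r * (inverse (a * r - c * r))\<^sup>2)) *\<^sub>R e
     + (2 * a * (c * r) * (inverse r * (inverse (a * r - c * r))\<^sup>2) - 2 * (inverse (a * r - c * r))\<^sup>2) *\<^sub>R x
     = landau a e x"
  proof -
    have f: "a * r - c * r = r * (a - c)" by (simp add: algebra_simps)
    have 1: "2 * inverse (a * r - c * r) = 2 / r * (1 / (a - c))"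
      unfolding f using r ac by (simp add: field_simps)
    \<comment> \<open>Clearing denominators leaves (a^2 - 1) - (a - c)^2 - c (a - c) = a c -
      1.\<close>
    have 2: "2 * a * (c * r) * (inverse r * (inverse (a * r - c * r))\<^sup>2) - 2 * (inverse (a * r - c * r))\<^sup>2
        = 2 / r * (((a\<^sup>2 - 1) / (a - c)\<^sup>2 - 1) / r - (1 / (a - c)) * (c / r))"
      unfolding f using r ac
      by (simp add: divide_simps power_mult_distrib power2_eq_square) (simp add: algebra_simps)
    have "landau a e x = (2 / r * (1 / (a - c))) *\<^sub>R e
        + (2 / r * (((a\<^sup>2 - 1) / (a - c)\<^sup>2 - 1) / r - (1 / (a - c)) * (c / r))) *\<^sub>R x"
      unfolding landau_def Let_def r_def[symmetric] c_def[symmetric] using x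
      by (simp only: if_False) (simp add: algebra_simps)
    then show ?thesis by (simp only: 1 2) simp
  qed
  finally show ?thesis .
qed

lemma is_landau_measurable: "is_landau v \<Longrightarrow> v \<in> borel_measurable borel"
  unfolding is_landau_def landau_def[abs_def] Let_def by auto measurable

lemma is_landau_divfree:
  assumes "is_landau v" shows "divfree v"
proof -
  have "divfree (landau a e)" if a: "\<bar>a\<bar> > 1" and e: "norm e = 1" for a e
  proof (rule divfree_limit)
    let ?d = "\<lambda>n. 1 / real (Suc n)"
    show "divfree (landau_reg a e (?d n))" "landau_reg a e (?d n) \<in> borel_measurable borel" for n
      using divfree_landau_reg[OF a e, of "?d n"] by (auto intro: borel_measurable_continuous_onI)
    show "norm (landau_reg a e (?d n) x)
    \<le> (2 / (\<bar>a\<bar> - 1) + 2 * \<bar>a\<bar> / (\<bar>a\<bar> - 1)\<^sup>2 + (2 * \<bar>a\<bar> / (\<bar>a\<bar> - 1)\<^sup>2 + 2 / (\<bar>a\<bar> - 1)\<^sup>2)) / norm x"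
      if "x \<noteq> 0" for n x
      using norm_landau_reg_le[OF a e _ that, of "?d n"] by simp
    show "(\<lambda>n. landau_reg a e (?d n) x) \<longlonglongrightarrow> landau a e x" if "x \<noteq> 0" for x
      using landau_reg_tendsto[OF a e that LIMSEQ_Suc[OF lim_1_over_n]] .
    show "landau a e \<in> borel_measurable borel"
      by (rule is_landau_measurable) (use a e in \<open>auto simp: is_landau_def\<close>)
  qed
  moreover have "divfree (\<lambda>_. 0)" by (simp add: divfree_def)
  ultimately show ?thesis using assms by (auto simp: is_landau_def)
qed

text \<open>The cosine is invariant under dilation and the remaining factors have total degree -1;
  the default value 0 at the origin is consistent with this.\<close>

lemma is_landau_scaleR:
  assumes "is_landau v" "l > 0"
  shows "l *\<^sub>R v (l *\<^sub>R x) = v x"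
proof -
  have "l *\<^sub>R landau a e (l *\<^sub>R x) = landau a e x" for a e
  proof (cases "x = 0")
    case False
    let ?c = "x \<bullet> e / norm x"
    have c: "(l *\<^sub>R x) \<bullet> e / norm (l *\<^sub>R x) = ?c" using assms(2) by simp
    have 1: "l * (2 / (l * norm x)) = 2 / norm x" using assms(2) by simp
    have 2: "(s / (l * norm x)) *\<^sub>R l *\<^sub>R x = (s / norm x) *\<^sub>R x" for s using assms(2) by simp
    show ?thesis
      unfolding landau_def Let_def c using False assms(2) 1 2 by (simp add: 2)
  qed (simp add: landau_def)
  then show ?thesis using assms(1) by (auto simp: is_landau_def)
qed

section \<open>The vortex\<close>

text \<open>The cross product of the third unit vector with \<open>x\<close>: the velocity field of
  a rigid rotation about the third axis.\<close>

definition swirl :: field3 where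
  "swirl x = (- x $ 2) *\<^sub>R axis 1 1 + x $ 1 *\<^sub>R axis 2 1"

lemma bounded_linear_swirl: "bounded_linear swirl"
proof -
  have "linear swirl"
    by (rule linearI) (simp_all add: swirl_def algebra_simps)
  then show ?thesis by (simp add: linear_conv_bounded_linear)
qed

lemma swirl_simps: "swirl x $ 1 = - x $ 2" "swirl x $ 2 = x $ 1" "swirl x $ 3 = 0"
  by (simp_all add: swirl_def axis_def)

lemma inner_swirl: "x \<bullet> swirl x = 0" "swirl x \<bullet> swirl x = (x $ 1)\<^sup>2 + (x $ 2)\<^sup>2"
  by (simp_all add: inner_vec_def sum_3 swirl_simps power2_eq_square)

lemma norm_swirl_le: "norm (swirl x) \<le> norm x"
proof -
  have "swirl x \<bullet> swirl x \<le> x \<bullet> x"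
    unfolding inner_swirl by (simp add: inner_vec_def sum_3 power2_eq_square)
  then show ?thesis by (simp add: norm_le)
qed

text \<open>The gradient of a radial function is parallel to \<open>x\<close>, hence orthogonal to
  \<open>swirl x\<close>, and the rotation itself has zero trace. The profile is a function of
  \<open>x \<bullet> x\<close> so that no differentiability is lost at the origin; leaving it free
  serves both the regularised vortex and the cut-off test field.\<close>

lemma radial_swirl:
  assumes G: "\<And>s. s \<ge> 0 \<Longrightarrow> (G has_real_derivative G' s) (at s)" and G': "continuous_on {0..} G'"
  shows "(\<lambda>x. G (x \<bullet> x) *\<^sub>R swirl x) differentiable (at x)"
    "continuous_on UNIV (pd i (\<lambda>x. G (x \<bullet> x) *\<^sub>R swirl x))"
    "divg (\<lambda>x. G (x \<bullet> x) *\<^sub>R swirl x) x = 0"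
proof -
  have dG: "((\<lambda>x. G (x \<bullet> x)) has_derivative (\<lambda>h. G' (x \<bullet> x) * (2 * (x \<bullet> h)))) (at x)" for x :: vec3
  proof -
    have "((\<lambda>x::vec3. x \<bullet> x) has_derivative (\<lambda>h. 2 * (x \<bullet> h))) (at x)"
      by (auto intro!: derivative_eq_intros simp: inner_commute)
    then show ?thesis
      by (rule has_derivative_compose) (use G[of "x \<bullet> x"] in \<open>simp add: has_field_derivative_def\<close>)
  qed
  have d: "((\<lambda>x. G (x \<bullet> x) *\<^sub>R swirl x) has_derivative
      (\<lambda>h. G (x \<bullet> x) *\<^sub>R swirl h + (G' (x \<bullet> x) * (2 * (x \<bullet> h))) *\<^sub>R swirl x)) (at x)" for x
    by (rule has_derivative_scaleR[OF dG bounded_linear_imp_has_derivative[OF bounded_linear_swirl]])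
  show "(\<lambda>x. G (x \<bullet> x) *\<^sub>R swirl x) differentiable (at x)" using d by (rule differentiableI)
  have pd: "pd i (\<lambda>x. G (x \<bullet> x) *\<^sub>R swirl x) x
     = G (x \<bullet> x) *\<^sub>R swirl (axis i 1) + (G' (x \<bullet> x) * (2 * x $ i)) *\<^sub>R swirl x" for i x
    using pd_eqI[OF d] by (simp add: inner_axis)
  have cG: "continuous_on {0..} G"
    using G by (meson DERIV_isCont atLeast_iff continuous_at_imp_continuous_on)
  have cs: "continuous_on UNIV swirl"
    by (rule linear_continuous_on[OF bounded_linear_swirl])
  have "continuous_on UNIV (\<lambda>x::vec3. G (x \<bullet> x))" "continuous_on UNIV (\<lambda>x::vec3. G' (x \<bullet> x))"
    by (rule continuous_on_compose2[OF cG] continuous_on_compose2[OF G']; auto intro!: continuous_intros)+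
  then show "continuous_on UNIV (pd i (\<lambda>x. G (x \<bullet> x) *\<^sub>R swirl x))"
    unfolding pd[abs_def] by (intro continuous_intros cs)
  have "swirl (axis 1 1) $ 1 = 0" "swirl (axis 2 1) $ 2 = 0"
    unfolding swirl_simps by (simp_all add: axis_def)
  then show "divg (\<lambda>x. G (x \<bullet> x) *\<^sub>R swirl x) x = 0"
    by (simp add: divg_def pd sum_3 swirl_simps)
qed

lemma vortex_divfree: "divfree (\<lambda>x. (c * inverse (x \<bullet> x)) *\<^sub>R swirl x)"
  and vortex_measurable: "(\<lambda>x. (c * inverse (x \<bullet> x)) *\<^sub>R swirl x) \<in> borel_measurable borel"
proof -
  have cs: "continuous_on UNIV swirl"
    by (rule linear_continuous_on[OF bounded_linear_swirl])
  then have [measurable]: "swirl \<in> borel_measurable borel"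
    by (rule borel_measurable_continuous_onI)
  show m: "(\<lambda>x. (c * inverse (x \<bullet> x)) *\<^sub>R swirl x) \<in> borel_measurable borel" by measurable
  define d where "d n = 1 / real (Suc n)" for n
  have d: "d n > 0" for n by (simp add: d_def)
  have dl: "d \<longlonglongrightarrow> 0" unfolding d_def by (rule LIMSEQ_Suc[OF lim_1_over_n])
  \<comment> \<open>Adding \<open>d n\<close> to |x|^2 makes the profile C^1 on the half line and
    only lowers its absolute value, so one multiple of 1/|x| dominates the whole sequence.\<close>
  let ?V = "\<lambda>n x. (c * inverse (x \<bullet> x + d n)) *\<^sub>R swirl x"
  show "divfree (\<lambda>x. (c * inverse (x \<bullet> x)) *\<^sub>R swirl x)"
  proof (rule divfree_limit[where V = ?V and C = "\<bar>c\<bar>"])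
    show "divfree (?V n)" for n
    proof (rule divg_0_imp_divfree)
      have G: "((\<lambda>s. c * inverse (s + d n)) has_real_derivative - c * (inverse (s + d n))\<^sup>2) (at s)" if "s \<ge> 0" for s
        using that d[of n] by (auto intro!: derivative_eq_intros simp: power2_eq_square)
      have G': "continuous_on {0..} (\<lambda>s. - c * (inverse (s + d n))\<^sup>2)"
        using d[of n] by (intro continuous_intros) (auto simp: add_nonneg_eq_0_iff)
      show "?V n differentiable (at x)" "continuous_on UNIV (pd i (?V n))" "divg (?V n) x = 0" for x i
        using radial_swirl[OF G G'] by auto
    qed
    show "?V n \<in> borel_measurable borel" for n by measurable
    show "norm (?V n x) \<le> \<bar>c\<bar> / norm x" if "x \<noteq> 0" for n x
    proof -
      have "norm (?V n x) \<le> \<bar>c\<bar> * inverse (x \<bullet> x + d n) * norm x"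
        using norm_swirl_le[of x] d[of n] by (auto simp: abs_mult intro!: mult_left_mono)
      also have "\<dots> \<le> \<bar>c\<bar> * inverse (x \<bullet> x) * norm x"
        using that d[of n] by (intro mult_right_mono mult_left_mono le_imp_inverse_le) auto
      also have "\<dots> = \<bar>c\<bar> / norm x"
        using that by (simp add: dot_square_norm power2_eq_square field_simps)
      finally show ?thesis .
    qed
    show "(\<lambda>n. ?V n x) \<longlonglongrightarrow> (c * inverse (x \<bullet> x)) *\<^sub>R swirl x" if "x \<noteq> 0" for x
    proof -
      have "(\<lambda>n. ?V n x) \<longlonglongrightarrow> (c * inverse (x \<bullet> x + 0)) *\<^sub>R swirl x"
        by (intro tendsto_intros dl) (use that in simp)
      then show ?thesis by simp
    qed
  qed (rule m)
qed

lemma norm_vortex_le: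
  assumes "c \<ge> 0" shows "norm ((c * inverse (x \<bullet> x)) *\<^sub>R swirl x) \<le> c / norm x"
proof -
  have "norm ((c * inverse (x \<bullet> x)) *\<^sub>R swirl x) \<le> c * inverse (x \<bullet> x) * norm x"
    using norm_swirl_le[of x] assms by (auto simp: abs_mult intro!: mult_left_mono)
  also have "\<dots> = c / norm x"
    by (cases "x = 0") (simp_all add: dot_square_norm power2_eq_square field_simps)
  finally show ?thesis .
qed

lemma vortex_scaleR:
  assumes "l > 0"
  shows "l *\<^sub>R ((c * inverse ((l *\<^sub>R x) \<bullet> (l *\<^sub>R x))) *\<^sub>R swirl (l *\<^sub>R x)) = (c * inverse (x \<bullet> x)) *\<^sub>R swirl x"
  using assms linear_cmul[OF bounded_linear.linear[OF bounded_linear_swirl]] by (simp add: field_simps)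

section \<open>Size of the vortex and its pairing with a test field\<close>

lemma wL3_le:
  fixes f :: "vec3 \<Rightarrow> 'b::real_normed_vector"
  assumes c: "c \<ge> 0" and f: "\<And>x. norm (f x) \<le> c / norm x"
  shows "wL3 f \<le> ennreal (unit_ball_vol 3 powr (1/3) * c)"
  unfolding wL3_def
proof (rule SUP_least)
  fix \<alpha> :: real assume "\<alpha> \<in> {0<..}"
  then have a: "\<alpha> > 0" by simp
  have "{x. \<alpha> < norm (f x)} \<subseteq> ball 0 (c / \<alpha>)"
  proof
    fix x assume "x \<in> {x. \<alpha> < norm (f x)}"
    then have *: "\<alpha> < c / norm x" using f[of x] by simp
    then have "norm x \<noteq> 0" using a by auto
    then show "x \<in> ball 0 (c / \<alpha>)" using * a by (simp add: field_simps)
  qed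
  then have "distf f \<alpha> \<le> emeasure lborel (ball (0::vec3) (c / \<alpha>))"
    unfolding distf_def by (intro emeasure_mono) auto
  also have "\<dots> = ennreal (unit_ball_vol 3 * (c / \<alpha>) ^ 3)"
    using c a by (simp add: emeasure_ball)
  finally have "enn_powr (distf f \<alpha>) (1/3) \<le> enn_powr (ennreal (unit_ball_vol 3 * (c / \<alpha>) ^ 3)) (1/3)"
    by (intro enn_powr_mono) simp_all
  also have "\<dots> = ennreal (unit_ball_vol 3 powr (1/3) * (c / \<alpha>))"
  proof -
    have "((c / \<alpha>) ^ 3) powr (1/3) = c / \<alpha>"
      using powr_powr[of "c / \<alpha>" 3 "1/3"] c a by simp
    then show ?thesis using c a by (simp add: enn_powr_def powr_mult)
  qed
  finally have "ennreal \<alpha> * enn_powr (distf f \<alpha>) (1/3) \<le> ennreal \<alpha> * ennreal (unit_ball_vol 3 powr (1/3) * (c / \<alpha>))"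
    by (intro mult_left_mono) simp_all
  also have "\<dots> = ennreal (unit_ball_vol 3 powr (1/3) * c)"
    using a c by (simp flip: ennreal_mult)
  finally show "ennreal \<alpha> * enn_powr (distf f \<alpha>) (1/3) \<le> ennreal (unit_ball_vol 3 powr (1/3) * c)" .
qed

text \<open>The squared positive part supplies a cut-off with the one continuous derivative that
  \<open>testfn\<close> demands: at the corner \<open>s = 1\<close> the difference quotient is at
  most |h|.\<close>

lemma max_square_has_derivative:
  "((\<lambda>s::real. (max 0 (1 - s))\<^sup>2) has_real_derivative - 2 * max 0 (1 - s)) (at s)"
proof -
  consider "s < 1" | "s > 1" | "s = 1" by linarith
  then show ?thesis
  proof cases
    case 1
    have "((\<lambda>s::real. (1 - s)\<^sup>2) has_real_derivative - 2 * (1 - s)) (at s)"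
      by (auto intro!: derivative_eq_intros)
    then have "((\<lambda>s::real. (max 0 (1 - s))\<^sup>2) has_real_derivative - 2 * (1 - s)) (at s)"
      by (rule has_field_derivative_transform_within_open[where S = "{..<1}"]) (use 1 in auto)
    then show ?thesis using 1 by simp
  next
    case 2
    have "((\<lambda>s::real. (max 0 (1 - s))\<^sup>2) has_real_derivative 0) (at s)"
      by (rule has_field_derivative_transform_within_open[where S = "{1<..}", OF DERIV_const]) (use 2 in auto)
    then show ?thesis using 2 by simp
  next
    case 3
    have "((\<lambda>h::real. ((max 0 (1 - (1 + h)))\<^sup>2 - (max 0 (1 - 1))\<^sup>2) / h) \<longlongrightarrow> 0) (at 0)"
    proof (rule Lim_null_comparison)
      show "\<forall>\<^sub>F h in at (0::real). norm (((max 0 (1 - (1 + h)))\<^sup>2 - (max 0 (1 - 1))\<^sup>2) / h) \<le> \<bar>h\<bar>"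
        by (intro always_eventually allI) (auto simp: max_def power2_eq_square)
      show "((\<lambda>h::real. \<bar>h\<bar>) \<longlongrightarrow> 0) (at 0)"
        using tendsto_rabs[OF tendsto_ident_at[of "0::real" UNIV]] by simp
    qed
    then show ?thesis using 3 by (simp add: DERIV_def)
  qed
qed

text \<open>The same rotation with a compactly supported radial profile in place of |x|^(-2) is an
  admissible solenoidal test field. Both fields point in the same direction, so the integrand of the
  pairing is nonnegative, and it is positive on an open ball.\<close>

lemma vortex_nontrivial:
  assumes c: "c > 0"
  obtains \<phi> :: field3 where "testfn \<phi>" "\<And>x. divg \<phi> x = 0"
    "(\<integral>x. ((c * inverse (x \<bullet> x)) *\<^sub>R swirl x) \<bullet> \<phi> x \<partial>lborel) \<noteq> 0"
proof -
  define G where "G s = (max 0 (1 - s))\<^sup>2" for s :: real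
  define \<phi> :: field3 where "\<phi> x = G (x \<bullet> x) *\<^sub>R swirl x" for x
  have dG: "(G has_real_derivative - 2 * max 0 (1 - s)) (at s)" for s
    unfolding G_def[abs_def] by (rule max_square_has_derivative)
  have cG: "continuous_on {0..} (\<lambda>s::real. - 2 * max 0 (1 - s))" by (intro continuous_intros)
  note \<phi>' = radial_swirl[OF dG cG, folded \<phi>_def[abs_def]]
  have G1: "G (x \<bullet> x) = 0" if "norm x \<ge> 1" for x :: vec3
    using one_le_power[OF that, of 2] by (simp add: G_def dot_square_norm)
  have t: "testfn \<phi>"
    unfolding testfn_def
  proof (intro conjI allI \<phi>')
    have "{x. \<phi> x \<noteq> 0} \<subseteq> cball 0 1"
      using G1 by (auto simp: \<phi>_def intro: ccontr)
    then show "bounded {x. \<phi> x \<noteq> 0}" by (rule bounded_subset[OF bounded_cball])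
  qed
  let ?g = "\<lambda>x. ((c * inverse (x \<bullet> x)) *\<^sub>R swirl x) \<bullet> \<phi> x"
  have g: "?g x = c * inverse (x \<bullet> x) * G (x \<bullet> x) * ((x $ 1)\<^sup>2 + (x $ 2)\<^sup>2)" for x
    by (simp add: \<phi>_def inner_swirl)
  have G0: "0 \<le> G s" "s \<ge> 0 \<Longrightarrow> G s \<le> 1" for s
    by (auto simp: G_def power_le_one)
  have g0: "0 \<le> ?g x" for x unfolding g using c G0 by (simp add: sum_power2_ge_zero)
  have int: "integrable lborel ?g"
  proof (rule integrable_bounded_support[where R = 1 and M = c])
    have [measurable]: "\<phi> \<in> borel_measurable borel"
      by (intro borel_measurable_continuous_onI testfn_continuous t)
    note [measurable] = vortex_measurable
    show "?g \<in> borel_measurable borel" by measurable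
    show "?g x = 0" if "norm x > 1" for x unfolding g using G1[of x] that by simp
    show "norm (?g x) \<le> c" for x
    proof -
      have "norm (?g x) \<le> norm ((c * inverse (x \<bullet> x)) *\<^sub>R swirl x) * norm (\<phi> x)"
        by (simp only: real_norm_def Cauchy_Schwarz_ineq2)
      also have "\<dots> \<le> (c / norm x) * (1 * norm x)"
        using norm_vortex_le[of c x] c norm_swirl_le[of x] G0[of "x \<bullet> x"]
        unfolding \<phi>_def norm_scaleR by (intro mult_mono) auto
      also have "\<dots> \<le> c" using c by simp
      finally show ?thesis .
    qed
  qed
  have "(\<integral>x. ?g x \<partial>lborel) \<noteq> 0"
  proof
    assume "(\<integral>x. ?g x \<partial>lborel) = 0"
    then have ae: "AE x in lborel. ?g x = 0"
      using integral_nonneg_eq_0_iff_AE[OF int] g0 by simp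
    \<comment> \<open>On this ball the first coordinate exceeds 1/4, which avoids the rotation axis,
      and |x| < 3/4, which stays where the cut-off is positive.\<close>
    let ?B = "ball (axis 1 (1/2) :: vec3) (1/4)"
    have "AE x in lborel. x \<notin> ?B"
      using ae
    proof eventually_elim
      fix x assume 0: "?g x = 0"
      show "x \<notin> ?B"
      proof
        assume "x \<in> ?B"
        then have B: "norm (x - axis 1 (1/2)) < 1/4" by (simp add: dist_norm norm_minus_commute)
        have "\<bar>(x - axis 1 (1/2)) $ 1\<bar> < 1/4" using component_le_norm_cart B le_less_trans by blast
        then have "\<bar>x $ 1 - 1/2\<bar> < 1/4" by (simp add: axis_def)
        then have x1: "x $ 1 > 0" by linarith
        have "norm x \<le> norm (x - axis 1 (1/2)) + norm (axis 1 (1/2) :: vec3)"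
          using norm_triangle_ineq[of "x - axis 1 (1/2)" "axis 1 (1/2)"] by simp
        moreover have "(axis 1 (1/2) :: vec3) = (1/2) *\<^sub>R axis 1 1"
          by (simp add: vec_eq_iff axis_def)
        then have "norm (axis 1 (1/2) :: vec3) = 1/2" by simp
        ultimately have "norm x < 1" using B by simp
        then have "x \<bullet> x < 1" by (simp add: dot_square_norm power_less_one_iff)
        then have "G (x \<bullet> x) > 0" by (simp add: G_def)
        moreover have "x \<bullet> x > 0" using x1 by auto
        moreover have "(x $ 1)\<^sup>2 + (x $ 2)\<^sup>2 > 0" using x1 by (simp add: add_pos_nonneg)
        ultimately have "?g x > 0" unfolding g using c by simp
        with 0 show False by (metis less_irrefl)
      qed
    qed
    moreover have "{x \<in> space lborel. \<not> x \<notin> ?B} = ?B" by auto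
    moreover have "?B \<in> sets lborel" by simp
    ultimately have "emeasure lborel ?B = 0"
      using AE_iff_measurable[of ?B lborel "\<lambda>x. x \<notin> ?B"] by blast
    then show False using unit_ball_vol_pos[of 3] by (simp add: emeasure_ball)
  qed
  with t \<phi>'(3) show thesis by (rule that)
qed

section \<open>Self-similarity\<close>

text \<open>The amplitude gives a factor \<open>l\<close> and the Jacobian l^(-3).\<close>

lemma pairing_scaleR:
  fixes f \<phi> :: field3
  assumes l: "l > 0"
  shows "(\<integral>x. (l *\<^sub>R f (l *\<^sub>R x)) \<bullet> \<phi> x \<partial>lborel) = (1 / l\<^sup>2) * (\<integral>x. f x \<bullet> \<phi> ((1 / l) *\<^sub>R x) \<partial>lborel)"
proof -
  have "(\<integral>x. f x \<bullet> \<phi> ((1 / l) *\<^sub>R x) \<partial>lborel) = l ^ 3 * (\<integral>x. f (l *\<^sub>R x) \<bullet> \<phi> x \<partial>lborel)"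
    using l by (subst lborel_integral_scaleR[of l]) auto
  moreover have "(\<integral>x. (l *\<^sub>R f (l *\<^sub>R x)) \<bullet> \<phi> x \<partial>lborel) = l * (\<integral>x. f (l *\<^sub>R x) \<bullet> \<phi> x \<partial>lborel)"
    by simp
  ultimately show ?thesis using l by (simp add: power2_eq_square power3_eq_cube)
qed

lemma heat_cmult:
  fixes f :: "vec3 \<Rightarrow> 'b::{banach, second_countable_topology}"
  shows "heat t (\<lambda>x. c *\<^sub>R f x) x = c *\<^sub>R heat t f x"
proof -
  have "(\<integral>y. heat_kernel t (x - y) *\<^sub>R c *\<^sub>R f y \<partial>lborel) = (\<integral>y. c *\<^sub>R heat_kernel t (x - y) *\<^sub>R f y \<partial>lborel)"
    by (simp add: mult.commute)
  then show ?thesis unfolding heat_def integral_scaleR_right by simp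
qed

lemma heat_homogeneous:
  fixes f :: "vec3 \<Rightarrow> 'b::{banach, second_countable_topology}"
  assumes l: "l > 0" and f: "\<And>x. l *\<^sub>R f (l *\<^sub>R x) = f x"
  shows "l *\<^sub>R heat (l\<^sup>2 * t) f (l *\<^sub>R x) = heat t f x"
  using heat_cmult[of t l "\<lambda>x. f (l *\<^sub>R x)" x] by (simp add: heat_scaleR[OF l] f)

lemma divfree_parabolic_scale:
  assumes f: "divfree f" and l: "l > 0"
  shows "divfree (\<lambda>x. l *\<^sub>R f (l *\<^sub>R x))"
  unfolding divfree_def
proof (intro allI impI)
  fix \<psi> :: "vec3 \<Rightarrow> real" assume \<psi>: "testfn \<psi>"
  let ?\<psi> = "\<lambda>x. \<psi> ((1 / l) *\<^sub>R x)"
  have d: "\<psi> differentiable (at x)" for x using \<psi> by (simp add: testfn_def)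
  have "testfn ?\<psi>" using \<psi> l by (intro testfn_scaleR) auto
  then have "0 = (\<integral>x. (\<Sum>i\<in>UNIV. f x $ i * pd i ?\<psi> x) \<partial>lborel)" using f by (simp add: divfree_def)
  also have "\<dots> = l ^ 3 * (\<integral>x. (\<Sum>i\<in>UNIV. f (l *\<^sub>R x) $ i * pd i ?\<psi> (l *\<^sub>R x)) \<partial>lborel)"
    using l by (subst lborel_integral_scaleR[of l]) auto
  finally have 0: "(\<integral>x. (\<Sum>i\<in>UNIV. f (l *\<^sub>R x) $ i * pd i ?\<psi> (l *\<^sub>R x)) \<partial>lborel) = 0"
    using l by simp
  have "(\<Sum>i\<in>UNIV. (l *\<^sub>R f (l *\<^sub>R x)) $ i * pd i \<psi> x)
      = l\<^sup>2 * (\<Sum>i\<in>UNIV. f (l *\<^sub>R x) $ i * pd i ?\<psi> (l *\<^sub>R x))" for x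
    unfolding pd_scaleR(2)[OF d] sum_distrib_left
    by (rule sum.cong) (use l in \<open>auto simp: power2_eq_square\<close>)
  then show "(\<integral>x. (\<Sum>i\<in>UNIV. (l *\<^sub>R f (l *\<^sub>R x)) $ i * pd i \<psi> x) \<partial>lborel) = 0"
    using 0 by simp
qed

lemma L3w_parabolic_scale:
  assumes f: "L3w f" and l: "l > 0"
  shows "L3w (\<lambda>x. l *\<^sub>R f (l *\<^sub>R x))"
proof -
  have m: "f \<in> borel_measurable borel" using f by (simp add: L3w_def)
  then have "(\<lambda>x. f (l *\<^sub>R x)) \<in> borel_measurable borel" using l by (simp add: borel_measurable_scaleR_iff)
  then show ?thesis using f wL3_parabolic_scale[OF m l] by (simp add: L3w_def)
qed

text \<open>At positive times the invariance of \<open>wL3\<close> reduces the claim to the change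
  of time \<open>s \<mapsto> l\<^sup>2 * s\<close>. At time zero the dilation is moved onto the test
  field, which stays in the duality class.\<close>

lemma CL3w_parabolic_scale:
  assumes u: "CL3w u" and l: "l > 0"
  shows "CL3w (\<lambda>t x. l *\<^sub>R u (l\<^sup>2 * t) (l *\<^sub>R x))"
  unfolding CL3w_def
proof (intro conjI allI impI)
  have L: "L3w (u t)" if "t \<ge> 0" for t using u that by (simp add: CL3w_def)
  show "L3w (\<lambda>x. l *\<^sub>R u (l\<^sup>2 * t) (l *\<^sub>R x))" if "t \<ge> 0" for t
    using that by (intro L3w_parabolic_scale L l) simp
  show "((\<lambda>s. wL3 (\<lambda>x. l *\<^sub>R u (l\<^sup>2 * s) (l *\<^sub>R x) - l *\<^sub>R u (l\<^sup>2 * t) (l *\<^sub>R x))) \<longlongrightarrow> 0) (at t within {0..})"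
    if t: "t > 0" for t
  proof -
    have lt: "l\<^sup>2 * t > 0" using l t by simp
    have "((\<lambda>s. wL3 (\<lambda>x. u s x - u (l\<^sup>2 * t) x)) \<longlongrightarrow> 0) (at (l\<^sup>2 * t) within {0..})"
      using u lt by (simp add: CL3w_def)
    moreover have "filterlim (\<lambda>s. l\<^sup>2 * s) (at (l\<^sup>2 * t) within {0..}) (at t within {0..})"
      unfolding filterlim_at
    proof
      show "((\<lambda>s. l\<^sup>2 * s) \<longlongrightarrow> l\<^sup>2 * t) (at t within {0..})" by (intro tendsto_intros)
      show "\<forall>\<^sub>F x in at t within {0..}. l\<^sup>2 * x \<in> {0..} \<and> l\<^sup>2 * x \<noteq> l\<^sup>2 * t"
        unfolding eventually_at_filter using l by (intro always_eventually) auto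
    qed
    ultimately have "((\<lambda>s. wL3 (\<lambda>x. u (l\<^sup>2 * s) x - u (l\<^sup>2 * t) x)) \<longlongrightarrow> 0) (at t within {0..})"
      by (rule filterlim_compose)
    then show ?thesis
    proof (rule Lim_transform_eventually)
      show "\<forall>\<^sub>F s in at t within {0..}. wL3 (\<lambda>x. u (l\<^sup>2 * s) x - u (l\<^sup>2 * t) x)
          = wL3 (\<lambda>x. l *\<^sub>R u (l\<^sup>2 * s) (l *\<^sub>R x) - l *\<^sub>R u (l\<^sup>2 * t) (l *\<^sub>R x))"
        unfolding eventually_at_filter
      proof (intro always_eventually allI impI)
        fix s :: real assume s: "s \<in> {0..}"
        have [measurable]: "u (l\<^sup>2 * s) \<in> borel_measurable borel" "u (l\<^sup>2 * t) \<in> borel_measurable borel"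
          using L[of "l\<^sup>2 * s"] L[of "l\<^sup>2 * t"] s t by (auto simp: L3w_def)
        have "(\<lambda>x. u (l\<^sup>2 * s) x - u (l\<^sup>2 * t) x) \<in> borel_measurable borel" by measurable
        from wL3_parabolic_scale[OF this l]
        show "wL3 (\<lambda>x. u (l\<^sup>2 * s) x - u (l\<^sup>2 * t) x)
          = wL3 (\<lambda>x. l *\<^sub>R u (l\<^sup>2 * s) (l *\<^sub>R x) - l *\<^sub>R u (l\<^sup>2 * t) (l *\<^sub>R x))"
          by (simp add: scaleR_diff_right)
      qed
    qed
  qed
  show "((\<lambda>t. \<integral>x. (l *\<^sub>R u (l\<^sup>2 * t) (l *\<^sub>R x)) \<bullet> \<phi> x \<partial>lborel) \<longlongrightarrow>
      (\<integral>x. (l *\<^sub>R u (l\<^sup>2 * 0) (l *\<^sub>R x)) \<bullet> \<phi> x \<partial>lborel)) (at_right 0)" if \<phi>: "L321 \<phi>" for \<phi> :: field3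
  proof -
    have "L321 (\<lambda>x. \<phi> ((1 / l) *\<^sub>R x))" using \<phi> l by (intro L321_scaleR) auto
    then have "((\<lambda>t. \<integral>x. u t x \<bullet> \<phi> ((1 / l) *\<^sub>R x) \<partial>lborel) \<longlongrightarrow> (\<integral>x. u 0 x \<bullet> \<phi> ((1 / l) *\<^sub>R x) \<partial>lborel)) (at_right 0)"
      using u by (simp add: CL3w_def)
    moreover have "filterlim (\<lambda>t. l\<^sup>2 * t) (at_right 0) (at_right 0)"
      unfolding filterlim_at
    proof
      have "((\<lambda>s. l\<^sup>2 * s) \<longlongrightarrow> l\<^sup>2 * 0) (at_right 0)" by (intro tendsto_intros)
      then show "((\<lambda>s. l\<^sup>2 * s) \<longlongrightarrow> 0) (at_right 0)" by simp
      show "\<forall>\<^sub>F x in at_right 0. l\<^sup>2 * x \<in> {0<..} \<and> l\<^sup>2 * x \<noteq> 0"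
        unfolding eventually_at_filter using l by (intro always_eventually) auto
    qed
    ultimately have "((\<lambda>t. \<integral>x. u (l\<^sup>2 * t) x \<bullet> \<phi> ((1 / l) *\<^sub>R x) \<partial>lborel) \<longlongrightarrow> (\<integral>x. u 0 x \<bullet> \<phi> ((1 / l) *\<^sub>R x) \<partial>lborel)) (at_right 0)"
      by (rule filterlim_compose)
    then show ?thesis
      unfolding pairing_scaleR[OF l] by (intro tendsto_mult tendsto_const) simp
  qed
qed

text \<open>The equation for \<open>u\<close> is taken at time \<open>l\<^sup>2 * t\<close> against
  \<phi>(x/l), which is again a solenoidal test field. Each of its three terms is
  \<open>l\<^sup>2\<close> times the corresponding term for the rescaled field: amplitude and
  Jacobian account for this in the pairings, the substitution in time in the Duhamel term.\<close>

lemma mild_sol_parabolic_scale: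
  assumes u: "mild_sol (\<lambda>t. U) u0 u" and l: "l > 0"
    and U: "\<And>x. l *\<^sub>R U (l *\<^sub>R x) = U x" and u0: "\<And>x. l *\<^sub>R u0 (l *\<^sub>R x) = u0 x"
  shows "mild_sol (\<lambda>t. U) u0 (\<lambda>t x. l *\<^sub>R u (l\<^sup>2 * t) (l *\<^sub>R x))"
  unfolding mild_sol_def
proof (intro conjI allI impI)
  have cl: "CL3w u" and dv: "\<And>t. t \<ge> 0 \<Longrightarrow> divfree (u t)" using u by (auto simp: mild_sol_def)
  show "CL3w (\<lambda>t x. l *\<^sub>R u (l\<^sup>2 * t) (l *\<^sub>R x))" by (rule CL3w_parabolic_scale[OF cl l])
  show "divfree (\<lambda>x. l *\<^sub>R u (l\<^sup>2 * t) (l *\<^sub>R x))" if "t \<ge> 0" for t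
    using that by (intro divfree_parabolic_scale dv l) simp
  fix t :: real and \<phi> :: field3
  assume t: "t \<ge> 0" and "testfn \<phi> \<and> (\<forall>x. divg \<phi> x = 0)"
  then have \<phi>: "testfn \<phi>" "\<And>x. divg \<phi> x = 0" by auto
  let ?\<phi> = "\<lambda>x. \<phi> ((1 / l) *\<^sub>R x)"
  have \<phi>': "testfn ?\<phi>" using \<phi>(1) l by (intro testfn_scaleR) auto
  have "\<phi> differentiable (at x)" for x using \<phi>(1) by (simp add: testfn_def)
  then have "divg ?\<phi> x = (1 / l) * divg \<phi> ((1 / l) *\<^sub>R x)" for x
    unfolding divg_def by (simp add: pd_scaleR(2) sum_divide_distrib)
  then have dv0: "divg ?\<phi> x = 0" for x using \<phi>(2) by simp
  define N where "N = (\<lambda>s y j k. u s y $ j * u s y $ k + U y $ j * u s y $ k + u s y $ j * U y $ k)"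
  define K where "K = (\<lambda>s. \<integral>y. (\<Sum>j\<in>(UNIV::3 set). \<Sum>k\<in>(UNIV::3 set). N s y j k
      * (pd k (heat (l\<^sup>2 * t - s) ?\<phi>) y $ j)) \<partial>lborel)"
  define v where "v = (\<lambda>s x. l *\<^sub>R u (l\<^sup>2 * s) (l *\<^sub>R x))"
  define Kv where "Kv = (\<lambda>s. \<integral>y. (\<Sum>j\<in>(UNIV::3 set). \<Sum>k\<in>(UNIV::3 set).
      (v s y $ j * v s y $ k + U y $ j * v s y $ k + v s y $ j * U y $ k)
      * (pd k (heat (t - s) \<phi>) y $ j)) \<partial>lborel)"
  have eq: "(\<integral>x. u (l\<^sup>2 * t) x \<bullet> ?\<phi> x \<partial>lborel) = (\<integral>x. heat (l\<^sup>2 * t) u0 x \<bullet> ?\<phi> x \<partial>lborel)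
      + set_lebesgue_integral lborel {0..l\<^sup>2 * t} K"
    using u t \<phi>' dv0 unfolding mild_sol_def K_def N_def by auto
  \<comment> \<open>The Jacobian \<open>l ^ 3\<close> splits into \<open>l\<^sup>2\<close> for the
    quadratic flux and \<open>l\<close> for the gradient of the heat evolution. Homogeneity of
    \<open>U\<close> makes the mixed terms scale like the quadratic one.\<close>
  have KK: "K (l\<^sup>2 * s) = Kv s" for s
  proof -
    let ?H = "heat (l\<^sup>2 * t - l\<^sup>2 * s) ?\<phi>"
    have H: "?H (l *\<^sub>R x) = heat (t - s) \<phi> x" for x
      using heat_scaleR[OF l, of "t - s" ?\<phi> x] l by (simp add: right_diff_distrib)
    have pdH: "pd k (heat (t - s) \<phi>) x = l *\<^sub>R pd k ?H (l *\<^sub>R x)" for k x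
      using pd_scaleR(2)[of ?H l x k] heat_differentiable[OF \<phi>'] by (simp add: H)
    have UU: "U x $ j = l * U (l *\<^sub>R x) $ j" for x j
      using arg_cong[OF U[of x], of "\<lambda>w. w $ j"] by simp
    have "K (l\<^sup>2 * s) = l ^ 3 * (\<integral>y. (\<Sum>j\<in>(UNIV::3 set). \<Sum>k\<in>(UNIV::3 set). N (l\<^sup>2 * s) (l *\<^sub>R y) j k
      * (pd k ?H (l *\<^sub>R y) $ j)) \<partial>lborel)"
      unfolding K_def using l by (subst lborel_integral_scaleR[of l]) auto
    also have "\<dots> = (\<integral>y. l ^ 3 * (\<Sum>j\<in>(UNIV::3 set). \<Sum>k\<in>(UNIV::3 set). N (l\<^sup>2 * s) (l *\<^sub>R y) j k
      * (pd k ?H (l *\<^sub>R y) $ j)) \<partial>lborel)"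
      by (rule integral_mult_right_zero[symmetric])
    also have "\<dots> = Kv s"
      unfolding Kv_def
    proof (rule Bochner_Integration.integral_cong[OF refl])
      fix y
      show "l ^ 3 * (\<Sum>j\<in>(UNIV::3 set). \<Sum>k\<in>(UNIV::3 set). N (l\<^sup>2 * s) (l *\<^sub>R y) j k * (pd k ?H (l *\<^sub>R y) $ j))
        = (\<Sum>j\<in>(UNIV::3 set). \<Sum>k\<in>(UNIV::3 set). (v s y $ j * v s y $ k + U y $ j * v s y $ k + v s y $ j * U y $ k)
            * (pd k (heat (t - s) \<phi>) y $ j))"
        unfolding sum_distrib_left
        by (intro sum.cong refl) (simp add: N_def v_def pdH UU[of y] algebra_simps power3_eq_cube)
    qed
    finally show ?thesis .
  qed
  have "set_lebesgue_integral lborel {0..l\<^sup>2 * t} K = l\<^sup>2 * set_lebesgue_integral lborel {0..t} Kv"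
  proof -
    have "set_lebesgue_integral lborel {0..l\<^sup>2 * t} K
       = \<bar>l\<^sup>2\<bar> *\<^sub>R (\<integral>s. indicator {0..l\<^sup>2 * t} (0 + l\<^sup>2 * s) *\<^sub>R K (0 + l\<^sup>2 * s) \<partial>lborel)"
      unfolding set_lebesgue_integral_def using l by (intro lborel_integral_real_affine) simp
    also have "(\<lambda>s. indicator {0..l\<^sup>2 * t} (0 + l\<^sup>2 * s) *\<^sub>R K (0 + l\<^sup>2 * s)) = (\<lambda>s. indicator {0..t} s *\<^sub>R Kv s)"
      using l by (auto simp: fun_eq_iff KK indicator_def zero_le_mult_iff)
    finally show ?thesis by (simp add: set_lebesgue_integral_def)
  qed
  moreover have "(\<integral>x. v t x \<bullet> \<phi> x \<partial>lborel) = (1 / l\<^sup>2) * (\<integral>x. u (l\<^sup>2 * t) x \<bullet> ?\<phi> x \<partial>lborel)"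
    unfolding v_def by (rule pairing_scaleR[OF l])
  moreover have "(\<integral>x. heat t u0 x \<bullet> \<phi> x \<partial>lborel) = (1 / l\<^sup>2) * (\<integral>x. heat (l\<^sup>2 * t) u0 x \<bullet> ?\<phi> x \<partial>lborel)"
    using pairing_scaleR[OF l, of "heat (l\<^sup>2 * t) u0" \<phi>] by (simp only: heat_homogeneous[where f = u0, OF l u0])
  ultimately have "(\<integral>x. v t x \<bullet> \<phi> x \<partial>lborel) = (\<integral>x. heat t u0 x \<bullet> \<phi> x \<partial>lborel) + set_lebesgue_integral lborel {0..t} Kv"
    using eq l by (simp add: distrib_left)
  then show "(\<integral>x. (l *\<^sub>R u (l\<^sup>2 * t) (l *\<^sub>R x)) \<bullet> \<phi> x \<partial>lborel) =
     (\<integral>x. heat t u0 x \<bullet> \<phi> x \<partial>lborel) +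
     set_lebesgue_integral lborel {0..t} (\<lambda>s. \<integral>y. (\<Sum>j\<in>(UNIV::3 set). \<Sum>k\<in>(UNIV::3 set).
       ((l *\<^sub>R u (l\<^sup>2 * s) (l *\<^sub>R y)) $ j * (l *\<^sub>R u (l\<^sup>2 * s) (l *\<^sub>R y)) $ k
        + U y $ j * (l *\<^sub>R u (l\<^sup>2 * s) (l *\<^sub>R y)) $ k + (l *\<^sub>R u (l\<^sup>2 * s) (l *\<^sub>R y)) $ j * U y $ k)
       * (pd k (heat (t - s) \<phi>) y $ j)) \<partial>lborel)"
    unfolding v_def Kv_def .
qed

lemma CL3w_const:
  assumes "L3w U" shows "CL3w (\<lambda>t. U)"
  using assms by (simp add: CL3w_def wL3_zero)

lemma sup_norm_parabolic_scale_le: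
  assumes "CL3w u" "l > 0"
  shows "sup_norm (\<lambda>t x. l *\<^sub>R u (l\<^sup>2 * t) (l *\<^sub>R x)) \<le> sup_norm u"
  unfolding sup_norm_def
proof (rule SUP_least)
  fix t :: real assume "t \<in> {0..}"
  then have t: "l\<^sup>2 * t \<in> {0..}" by simp
  then have "u (l\<^sup>2 * t) \<in> borel_measurable borel" using assms(1) by (simp add: CL3w_def L3w_def)
  from wL3_parabolic_scale[OF this assms(2)] t
  show "wL3 (\<lambda>x. l *\<^sub>R u (l\<^sup>2 * t) (l *\<^sub>R x)) \<le> (SUP t\<in>{0..}. wL3 (u t))"
    using SUP_upper[of "l\<^sup>2 * t" "{0..}" "\<lambda>t. wL3 (u t)"] by simp
qed

lemma gwp_self_similar:
  assumes gwp: "gwp_const \<epsilon>2 A C"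
    and U: "L3w U" "divfree U" "wL3 U < ennreal A" "\<And>l x. l > 0 \<Longrightarrow> l *\<^sub>R U (l *\<^sub>R x) = U x"
    and u0: "L3w u0" "divfree u0" "wL3 u0 < ennreal \<epsilon>2" "\<And>l x. l > 0 \<Longrightarrow> l *\<^sub>R u0 (l *\<^sub>R x) = u0 x"
    and u: "mild_sol (\<lambda>t. U) u0 u" "sup_norm u \<le> ennreal C * wL3 u0"
    and t: "t > 0"
  shows "wL3 (u t) = wL3 (u 1)"
proof -
  have cl: "CL3w u" using u(1) by (simp add: mild_sol_def)
  then have m: "u s \<in> borel_measurable borel" if "s \<ge> 0" for s using that by (simp add: CL3w_def L3w_def)
  \<comment> \<open>This dilation carries time \<open>t\<close> to time 1, so values at the single
    time 1 are compared.\<close>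
  define l where "l = sqrt t"
  have l: "l > 0" "l\<^sup>2 = t" using t by (simp_all add: l_def)
  let ?v = "\<lambda>t x. l *\<^sub>R u (l\<^sup>2 * t) (l *\<^sub>R x)"
  have v: "mild_sol (\<lambda>t. U) u0 ?v" by (rule mild_sol_parabolic_scale[where U = U, OF u(1) l(1) U(4)[OF l(1)] u0(4)[OF l(1)]])
  have sv: "sup_norm ?v \<le> ennreal C * wL3 u0"
    using sup_norm_parabolic_scale_le[OF cl l(1)] u(2) by (rule order_trans)
  have "sup_norm (\<lambda>t. U) < ennreal A" using U(3) by (simp add: sup_norm_def)
  then have "CL3w (\<lambda>t. U) \<and> (\<forall>t\<ge>0. divfree U) \<and> sup_norm (\<lambda>t. U) < ennreal A \<and>
     L3w u0 \<and> divfree u0 \<and> wL3 u0 < ennreal \<epsilon>2"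
    using CL3w_const[OF U(1)] U(2) u0(1,2,3) by simp
  \<comment> \<open>Here \<open>u\<close> is an arbitrary solution in the uniqueness class, so
    \<open>u\<close> and its rescaled copy are both compared with the solution \<open>w\<close> that
    the existence part supplies.\<close>
  from mp[OF gwp[unfolded gwp_const_def, THEN spec, of "\<lambda>t. U", THEN spec, of u0] this]
  obtain w where w: "\<And>v. mild_sol (\<lambda>t. U) u0 v \<Longrightarrow> sup_norm v \<le> ennreal C * wL3 u0
      \<Longrightarrow> (\<forall>t\<ge>0. AE x in lborel. v t x = w t x)"
    by (elim exE conjE) blast
  have "AE x in lborel. ?v 1 x = u 1 x"
    using w[OF v sv, THEN spec, of 1] w[OF u, THEN spec, of 1] by auto
  moreover have "?v 1 \<in> borel_measurable borel"
    using CL3w_parabolic_scale[OF cl l(1), unfolded CL3w_def, THEN conjunct1, THEN spec, of 1] by (simp add: L3w_def)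
  ultimately have "wL3 (?v 1) = wL3 (u 1)" using m by (intro wL3_cong_AE) auto
  moreover have "wL3 (?v 1) = wL3 (u t)"
    using wL3_parabolic_scale[OF m[of t] l(1)] t l(2) by simp
  ultimately show ?thesis by simp
qed

text \<open>The link to the datum has two stages: the pairings of \<open>u 0\<close> are limits of
  those at positive times, and the equation at time zero identifies them with the pairings of
  \<open>u0\<close>. Since the equation is tested against solenoidal fields, the conclusion concerns
  those.\<close>

lemma mild_sol_initial:
  assumes u: "mild_sol U u0 u" and 0: "\<And>t. t > 0 \<Longrightarrow> wL3 (u t) = 0"
    and \<phi>: "testfn \<phi>" "\<And>x. divg \<phi> x = 0"
  shows "(\<integral>x. u0 x \<bullet> \<phi> x \<partial>lborel) = 0"
proof -
  have cl: "CL3w u" using u by (simp add: mild_sol_def)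
  have "(\<integral>x. u t x \<bullet> \<phi> x \<partial>lborel) = 0" if t: "t > 0" for t
  proof -
    have "u t \<in> borel_measurable borel" using cl t by (simp add: CL3w_def L3w_def)
    then have "AE x in lborel. u t x = 0" using 0[OF t] by (rule wL3_eq_0_imp_AE)
    then have "AE x in lborel. u t x \<bullet> \<phi> x = 0" by eventually_elim simp
    then show ?thesis by (rule integral_eq_zero_AE)
  qed
  then have "\<forall>\<^sub>F t in at_right 0. (\<integral>x. u t x \<bullet> \<phi> x \<partial>lborel) = 0"
    unfolding eventually_at_filter by (intro always_eventually) simp
  then have "((\<lambda>t. \<integral>x. u t x \<bullet> \<phi> x \<partial>lborel) \<longlongrightarrow> 0) (at_right 0)"
    by (rule tendsto_eventually)
  moreover have "((\<lambda>t. \<integral>x. u t x \<bullet> \<phi> x \<partial>lborel) \<longlongrightarrow> (\<integral>x. u 0 x \<bullet> \<phi> x \<partial>lborel)) (at_right 0)"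
    using cl testfn_L321[OF \<phi>(1)] by (simp add: CL3w_def)
  ultimately have "(\<integral>x. u 0 x \<bullet> \<phi> x \<partial>lborel) = 0"
    using tendsto_unique[OF trivial_limit_at_right_real] by blast
  \<comment> \<open>At time zero the Duhamel integral runs over a single point, hence over a null
    set, and \<open>heat 0\<close> is the identity by convention.\<close>
  moreover have "set_lebesgue_integral lborel {0..0::real} f = 0" for f :: "real \<Rightarrow> real"
  proof -
    have "AE s in lborel. indicator {0..0::real} s *\<^sub>R f s = 0"
      using AE_lborel_singleton[of "0::real"] by eventually_elim (simp add: indicator_def)
    then show ?thesis unfolding set_lebesgue_integral_def by (rule integral_eq_zero_AE)
  qed
  moreover have "heat 0 u0 = u0" by (simp add: heat_def fun_eq_iff)
  ultimately show ?thesis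
    using u \<phi> unfolding mild_sol_def by (auto dest!: spec[of _ "0::real"] spec[of _ \<phi>])
qed

text \<open>The vortex depends on \<open>\<epsilon>\<close> alone, so one datum serves all
  admissible \<open>A\<close>, \<open>C\<close> and \<open>u\<close>. The norm being constant for
  positive times, the upper limit equals its value at time 1.\<close>

theorem theorem1p3:
  fixes \<epsilon>1 \<epsilon>2 :: real and uL :: field3
  assumes "\<epsilon>1 > 0" and "\<epsilon>2 > 0"
    and gwp: "\<forall>A. 0 < A \<and> A < \<epsilon>1 \<longrightarrow> (\<exists>C. gwp_const \<epsilon>2 A C)"
    and "is_landau uL" and "wL3 uL < ennreal \<epsilon>1"
  shows "\<forall>\<epsilon>. 0 < \<epsilon> \<and> \<epsilon> < \<epsilon>2 \<longrightarrow>
           (\<exists>u0. L3w u0 \<and> divfree u0 \<and> wL3 u0 < ennreal \<epsilon> \<and>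
              (\<forall>A C u. wL3 uL < ennreal A \<and> A < \<epsilon>1 \<and> gwp_const \<epsilon>2 A C \<and>
                   mild_sol (\<lambda>t. uL) u0 u \<and> sup_norm u \<le> ennreal C * wL3 u0 \<longrightarrow>
                   Limsup at_top (\<lambda>t. wL3 (u t)) > 0))"
proof (intro allI impI, elim conjE)
  fix \<epsilon> :: real assume \<epsilon>: "0 < \<epsilon>" "\<epsilon> < \<epsilon>2"
  let ?k = "unit_ball_vol 3 powr (1/3) :: real"
  \<comment> \<open>Adding 1 makes positivity of \<open>K\<close> immediate; with
    \<open>c = \<epsilon> / (2 * K)\<close> the norm of the datum is at most half of
    \<open>\<epsilon>\<close>.\<close>
  define K where "K = ?k + 1"
  define c where "c = \<epsilon> / (2 * K)"
  define u0 :: field3 where "u0 x = (c * inverse (x \<bullet> x)) *\<^sub>R swirl x" for x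
  have k: "K > 0" unfolding K_def by (intro add_nonneg_pos) auto
  then have c: "c > 0" using \<epsilon> by (simp add: c_def)
  have "?k * c \<le> K * c" using c by (simp add: K_def)
  also have "\<dots> < \<epsilon>" using k \<epsilon> by (simp add: c_def)
  finally have kc: "?k * c < \<epsilon>" .
  have "wL3 u0 \<le> ennreal (?k * c)"
    unfolding u0_def[abs_def] using c norm_vortex_le by (intro wL3_le) auto
  also have "\<dots> < ennreal \<epsilon>" using kc \<epsilon> by (simp add: ennreal_lessI)
  finally have small: "wL3 u0 < ennreal \<epsilon>" .
  have L: "L3w u0"
    using small vortex_measurable[of c] by (auto simp: L3w_def u0_def[abs_def] intro: less_trans)
  have df: "divfree u0" unfolding u0_def[abs_def] by (rule vortex_divfree)
  have hom: "l *\<^sub>R u0 (l *\<^sub>R x) = u0 x" if "l > 0" for l x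
    unfolding u0_def by (rule vortex_scaleR[OF that])
  have LU: "L3w uL"
    using assms(5) is_landau_measurable[OF assms(4)] by (auto simp: L3w_def intro: less_trans)
  obtain \<phi> where \<phi>: "testfn \<phi>" "\<And>x. divg \<phi> x = 0" "(\<integral>x. u0 x \<bullet> \<phi> x \<partial>lborel) \<noteq> 0"
    by (rule vortex_nontrivial[OF c, folded u0_def]) (rule that)
  have "Limsup at_top (\<lambda>t. wL3 (u t)) > 0"
    if "wL3 uL < ennreal A" "gwp_const \<epsilon>2 A C" "mild_sol (\<lambda>t. uL) u0 u" "sup_norm u \<le> ennreal C * wL3 u0" for A C u
  proof -
    have s2: "wL3 u0 < ennreal \<epsilon>2" using small \<epsilon> by (meson ennreal_leI less_imp_le less_le_trans)
    have const: "wL3 (u t) = wL3 (u 1)" if "t > 0" for t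
      using gwp_self_similar[where U = uL and ?u0.0 = u0, OF \<open>gwp_const \<epsilon>2 A C\<close> LU is_landau_divfree[OF assms(4)] \<open>wL3 uL < ennreal A\<close>
          is_landau_scaleR[OF assms(4)] L df s2 hom \<open>mild_sol (\<lambda>t. uL) u0 u\<close> \<open>sup_norm u \<le> _\<close> that] .
    have "wL3 (u 1) \<noteq> 0"
    proof
      assume "wL3 (u 1) = 0"
      then have "wL3 (u t) = 0" if "t > 0" for t using const[OF that] by simp
      then show False using mild_sol_initial[OF \<open>mild_sol (\<lambda>t. uL) u0 u\<close> _ \<phi>(1,2)] \<phi>(3) by blast
    qed
    moreover have "Limsup at_top (\<lambda>t. wL3 (u t)) = wL3 (u 1)"
      by (intro lim_imp_Limsup tendsto_eventually)
         (auto intro: eventually_mono[OF eventually_gt_at_top[of 0]] const)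
    ultimately show ?thesis by (simp add: zero_less_iff_neq_zero)
  qed
  then show "\<exists>u0. L3w u0 \<and> divfree u0 \<and> wL3 u0 < ennreal \<epsilon> \<and>
              (\<forall>A C u. wL3 uL < ennreal A \<and> A < \<epsilon>1 \<and> gwp_const \<epsilon>2 A C \<and>
                   mild_sol (\<lambda>t. uL) u0 u \<and> sup_norm u \<le> ennreal C * wL3 u0 \<longrightarrow>
                   Limsup at_top (\<lambda>t. wL3 (u t)) > 0)"
    using L df small by blast
qed

end
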